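(* For $n\geq 4$, \[ a_n(213;321) = \begin{cases} a_{n-1}(213;321) + n-3 & \text{if } n \text{ is even},\\ a_{n-1}(213;321) + n-3 + \frac{n-3}{2} & \text{if } n \text{ is odd},\end{cases} \] which has closed form \[ a_n(213;321) = \binom{n-2}{2} + \binom{\lceil (n-2)/2\rceil}{2} + 2. \]
   Context: $\mathcal{S}_n$ is the set of permutations of $[n]=\{1,\dots,n\}$, written in one-line notation $\pi=\pi_1\pi_2\cdots\pi_n$ with $\pi_i=\pi(i)$. A permutation is cyclic if it consists of exactly one $n$-cycle. For a cyclic $\pi$, its standard cycle notation is $C(\pi)=(c_1,c_2,\dots,c_n)$ with $c_1=1$ and $c_i=\pi_{c_{i-1}}$ for $2\le i\le n$. A sequence of distinct integers $w_1\cdots w_m$ contains a pattern $\sigma\in\mathcal{S}_k$ if there are indices $i_1<\dots<i_k$ with $w_{i_1}\cdots w_{i_k}$ in the same relative order as $\sigma_1\cdots\sigma_k$; otherwise it avoids $\sigma$. For $\sigma,\tau\in\mathcal{S}_3$, $\mathcal{A}_n(\sigma;\tau)$ is the set of cyclic permutations $\pi\in\mathcal{S}_n$ whose one-line notation avoids $\sigma$ and whose cycle notation $C(\pi)$ (as the sequence $c_1c_2\cdots c_n$) avoids $\tau$; $a_n(\sigma;\tau)=|\mathcal{A}_n(\sigma;\tau)|$. *)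

theory Defs
  imports Complex_Main "HOL-Combinatorics.Combinatorics"
begin

text \<open>
  A permutation of \<open>{1..n}\<close> is a function \<open>\<pi>\<close> with \<open>\<pi> permutes {1..n}\<close> (so it is the identity
  outside \<open>{1..n}\<close>, and distinct functions are distinct permutations).
  Sequences and patterns are lists of naturals; list positions count from 0.
\<close>

definition one_line :: "nat \<Rightarrow> (nat \<Rightarrow> nat) \<Rightarrow> nat list" where
  "one_line n \<pi> = map \<pi> [1..<Suc n]"

text \<open>The list \<open>[1, \<pi> 1, \<pi> (\<pi> 1), \<dots>]\<close> of length \<open>n\<close>; meaningful when \<open>\<pi>\<close> is an \<open>n\<close>-cycle on \<open>{1..n}\<close>.\<close>

definition cycle_notation :: "nat \<Rightarrow> (nat \<Rightarrow> nat) \<Rightarrow> nat list" where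
  "cycle_notation n \<pi> = map (\<lambda>i. (\<pi> ^^ i) 1) [0..<n]"

definition contains_pattern :: "nat list \<Rightarrow> nat list \<Rightarrow> bool" where
  "contains_pattern w \<sigma> \<longleftrightarrow>
     (\<exists>f :: nat \<Rightarrow> nat. strict_mono_on {..<length \<sigma>} f \<and> f ` {..<length \<sigma>} \<subseteq> {..<length w} \<and>
       (\<forall>i<length \<sigma>. \<forall>j<length \<sigma>. w ! f i < w ! f j \<longleftrightarrow> \<sigma> ! i < \<sigma> ! j))"

definition avoids :: "nat list \<Rightarrow> nat list \<Rightarrow> bool" where
  "avoids w \<sigma> \<longleftrightarrow> \<not> contains_pattern w \<sigma>"

definition cyc_avoiders :: "nat \<Rightarrow> nat list \<Rightarrow> nat list \<Rightarrow> (nat \<Rightarrow> nat) set" where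
  "cyc_avoiders n \<sigma> \<tau> =
     {\<pi>. \<pi> permutes {1..n} \<and> cyclic_on \<pi> {1..n} \<and>
         avoids (one_line n \<pi>) \<sigma> \<and> avoids (cycle_notation n \<pi>) \<tau>}"

definition num_cyc_avoiders :: "nat \<Rightarrow> nat list \<Rightarrow> nat list \<Rightarrow> nat" where
  "num_cyc_avoiders n \<sigma> \<tau> = card (cyc_avoiders n \<sigma> \<tau>)"

end

theory Submission
  imports Defs
begin

text \<open>
  Let \<open>j = \<pi> 1\<close> and \<open>m = n + 1 - j\<close>. Avoiding \<open>213\<close> forces \<open>\<pi>\<close> to exceed \<open>j\<close> exactly on
  \<open>{2..m}\<close>, and since \<open>j\<close> comes second in the cycle notation, avoiding \<open>321\<close> forces
  \<open>2, \<dots>, j - 1\<close> to occur there in increasing order. For \<open>j \<ge> 3\<close> this determines \<open>\<pi>\<close> up to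
  few parameters: the elements between consecutive small entries of the cycle are forced
  almost everywhere, and on the remaining middle segment \<open>{j - 1..m}\<close> the map \<open>\<pi>\<close> has only
  excedances, so that it is \<open>x \<mapsto> x + 2\<close> up to one point and \<open>x \<mapsto> x + 1\<close> after it. There
  are four families, two of which consist of the permutations with \<open>\<pi> n = 1\<close>. For \<open>j = 2\<close>
  deleting \<open>1\<close> from the cycle leaves an avoider of size \<open>n - 1\<close> with \<open>\<pi> (n - 1) = 1\<close>,
  which gives a recursion for the avoiders ending in \<open>1\<close>.
\<close>

subsection \<open>Pattern avoidance of cyclic permutations via positions in the cycle\<close>

text \<open>The position function \<open>p\<close> ties the two notations together: a
  \<open>321\<close> in the cycle is a decreasing triple of elements with increasing
  \<open>p\<close>, and \<open>p (\<pi> x) = Suc (p x)\<close> lets nothing come between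
  \<open>x\<close> and its image. Most contradictions rest on this adjacency.

  Parity enters through \<open>x \<mapsto> x + 2\<close>, which splits the middle segment into two
  classes. The exceptional point, where the segment is left, has to lie in the right one: otherwise
  the orbit of \<open>1\<close> closes too early, or \<open>2\<close> comes after
  \<open>j - 1\<close> in the cycle. This restricts the exceptional point to one parity and is one
  source of the halves in the count.

  The recursion stays among the permutations ending in \<open>1\<close> because
  \<open>\<pi> 1 = 2\<close> already forces \<open>\<pi> n = 1\<close>: behind the entry
  \<open>1\<close> nothing above \<open>2\<close> may follow. In the final count the pairs
  \<open>(j, d)\<close> of \<open>small_last\<close> give the second binomial coefficient, and
  everything else gives the first one plus 2.\<close>

lemma contains_pattern_3_iff:
  "contains_pattern w [r,s,t] \<longleftrightarrow>
     (\<exists>a b c. a < b \<and> b < c \<and> c < length w \<and>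
       (w ! a < w ! b \<longleftrightarrow> r < s) \<and> (w ! b < w ! a \<longleftrightarrow> s < r) \<and>
       (w ! a < w ! c \<longleftrightarrow> r < t) \<and> (w ! c < w ! a \<longleftrightarrow> t < r) \<and>
       (w ! b < w ! c \<longleftrightarrow> s < t) \<and> (w ! c < w ! b \<longleftrightarrow> t < s))"
  (is "_ \<longleftrightarrow> ?R")
proof -
  have set3: "{..<3} = {0, 1, 2 :: nat}" by auto
  have all3: "(\<forall>i<3. P i) \<longleftrightarrow> P 0 \<and> P 1 \<and> P (2 :: nat)" for P
    by (auto simp: numeral_3_eq_3 numeral_2_eq_2 less_Suc_eq)
  have "contains_pattern w [r,s,t] \<longleftrightarrow>
    (\<exists>f :: nat \<Rightarrow> nat. strict_mono_on {0, 1, 2} f \<and> f ` {0, 1, 2} \<subseteq> {..<length w} \<and>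
       (\<forall>i<3. \<forall>j<3. w ! f i < w ! f j \<longleftrightarrow> [r,s,t] ! i < [r,s,t] ! j))"
    by (simp add: contains_pattern_def set3 flip: numeral_3_eq_3)
  also have "\<dots> \<longleftrightarrow> ?R"
  proof
    assume "\<exists>f :: nat \<Rightarrow> nat. strict_mono_on {0, 1, 2} f \<and> f ` {0, 1, 2} \<subseteq> {..<length w} \<and>
       (\<forall>i<3. \<forall>j<3. w ! f i < w ! f j \<longleftrightarrow> [r,s,t] ! i < [r,s,t] ! j)"
    then obtain f :: "nat \<Rightarrow> nat" where "strict_mono_on {0, 1, 2} f"
      "f ` {0, 1, 2} \<subseteq> {..<length w}"
      and ord: "\<And>i j. i < 3 \<Longrightarrow> j < 3 \<Longrightarrow> w ! f i < w ! f j \<longleftrightarrow> [r,s,t] ! i < [r,s,t] ! j" by blast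
    then have "f 0 < f 1" "f 1 < f 2" "f 2 < length w" by (auto simp: strict_mono_on_def)
    then show ?R
      using ord[of 0 1] ord[of 1 0] ord[of 0 2] ord[of 2 0] ord[of 1 2] ord[of 2 1]
      by (intro exI[of _ "f 0"] exI[of _ "f 1"] exI[of _ "f 2"]) simp
  next
    assume ?R
    then obtain a b c where *: "a < b" "b < c" "c < length w"
       "(w ! a < w ! b \<longleftrightarrow> r < s)" "(w ! b < w ! a \<longleftrightarrow> s < r)"
       "(w ! a < w ! c \<longleftrightarrow> r < t)" "(w ! c < w ! a \<longleftrightarrow> t < r)"
       "(w ! b < w ! c \<longleftrightarrow> s < t)" "(w ! c < w ! b \<longleftrightarrow> t < s)" by blast
    show "\<exists>f :: nat \<Rightarrow> nat. strict_mono_on {0, 1, 2} f \<and> f ` {0, 1, 2} \<subseteq> {..<length w} \<and>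
       (\<forall>i<3. \<forall>j<3. w ! f i < w ! f j \<longleftrightarrow> [r,s,t] ! i < [r,s,t] ! j)"
    proof (intro exI conjI)
      show "strict_mono_on {0, 1, 2} (\<lambda>i. [a,b,c] ! i)"
        using * by (auto intro!: strict_mono_onI)
      show "(\<lambda>i. [a,b,c] ! i) ` {0, 1, 2} \<subseteq> {..<length w}"
        using * by auto
      show "\<forall>i<3. \<forall>j<3. w ! ([a,b,c] ! i) < w ! ([a,b,c] ! j) \<longleftrightarrow> [r,s,t] ! i < [r,s,t] ! j"
        using * by (simp add: all3)
    qed
  qed
  finally show ?thesis .
qed

lemma contains_213_iff:
  "contains_pattern w [2,1,3] \<longleftrightarrow>
     (\<exists>a b c. a < b \<and> b < c \<and> c < length w \<and> w ! b < w ! a \<and> w ! a < w ! c)"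
  unfolding contains_pattern_3_iff by (rule iff_exI)+ auto

lemma contains_321_iff:
  "contains_pattern w [3,2,1] \<longleftrightarrow>
     (\<exists>a b c. a < b \<and> b < c \<and> c < length w \<and> w ! c < w ! b \<and> w ! b < w ! a)"
  unfolding contains_pattern_3_iff by (rule iff_exI)+ auto

text \<open>\<open>p x\<close> is the index of \<open>x\<close> in the cycle notation of \<open>\<pi>\<close>; its existence
  encodes that \<open>\<pi>\<close> is an \<open>n\<close>-cycle.\<close>

locale cycle_position =
  fixes n :: nat and \<pi> p :: "nat \<Rightarrow> nat"
  assumes n_pos: "1 \<le> n"
    and maps: "x \<in> {1..n} \<Longrightarrow> \<pi> x \<in> {1..n}"
    and outside: "x \<notin> {1..n} \<Longrightarrow> \<pi> x = x"
    and pos_1: "p 1 = 0"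
    and pos_less: "x \<in> {1..n} \<Longrightarrow> p x < n"
    and pos_step: "x \<in> {1..n} \<Longrightarrow> Suc (p x) < n \<Longrightarrow> p (\<pi> x) = Suc (p x)"
    and pos_last: "x \<in> {1..n} \<Longrightarrow> Suc (p x) = n \<Longrightarrow> \<pi> x = 1"
begin

lemma funpow_in: "(\<pi> ^^ i) 1 \<in> {1..n}"
proof (induction i)
  case 0
  then show ?case using n_pos by simp
next
  case (Suc i)
  then show ?case using maps by simp
qed

lemma pos_funpow: "i < n \<Longrightarrow> p ((\<pi> ^^ i) 1) = i"
proof (induction i)
  case 0
  then show ?case using pos_1 by simp
next
  case (Suc i)
  then have "p ((\<pi> ^^ i) 1) = i" by simp
  with Suc.prems have "p (\<pi> ((\<pi> ^^ i) 1)) = Suc i"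
    using pos_step[OF funpow_in[of i]] by simp
  then show ?case by simp
qed

text \<open>By \<open>pos_funpow\<close>, \<open>p\<close> recovers the exponent, so the first
  \<open>n\<close> iterates are distinct; being \<open>n\<close> elements of an
  \<open>n\<close>-element set, they exhaust it.\<close>

lemma funpow_image: "(\<lambda>i. (\<pi> ^^ i) 1) ` {..<n} = {1..n}"
proof (rule card_subset_eq)
  have "inj_on (\<lambda>i. (\<pi> ^^ i) 1) {..<n}"
    by (rule inj_on_inverseI[where g = p]) (simp add: pos_funpow[unfolded One_nat_def])
  then show "card ((\<lambda>i. (\<pi> ^^ i) 1) ` {..<n}) = card {1..n}"
    by (simp add: card_image)
  show "(\<lambda>i. (\<pi> ^^ i) 1) ` {..<n} \<subseteq> {1..n}"
    by (rule image_subsetI) (rule funpow_in)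
qed simp

lemma funpow_pos:
  assumes "x \<in> {1..n}"
  shows "(\<pi> ^^ p x) 1 = x"
proof -
  have "x \<in> (\<lambda>i. (\<pi> ^^ i) 1) ` {..<n}"
    unfolding funpow_image by (rule assms)
  then obtain i where "i < n" and x: "x = (\<pi> ^^ i) 1"
    by blast
  then have "p x = i" by (simp only: pos_funpow)
  then show ?thesis using x by simp
qed

lemma pos_eq_iff: "x \<in> {1..n} \<Longrightarrow> y \<in> {1..n} \<Longrightarrow> p x = p y \<longleftrightarrow> x = y"
  by (metis funpow_pos)

lemma pos_image: "\<pi> x \<noteq> 1 \<Longrightarrow> x \<in> {1..n} \<Longrightarrow> p (\<pi> x) = Suc (p x)"
  using pos_step pos_last pos_less by (metis Suc_lessI)

lemma pos_gt_0: "x \<in> {1..n} \<Longrightarrow> x \<noteq> 1 \<Longrightarrow> 0 < p x"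
  by (metis funpow_0 funpow_pos gr0I)

lemma funpow_n: "(\<pi> ^^ n) 1 = 1"
proof -
  have "\<pi> ((\<pi> ^^ (n - 1)) 1) = 1"
    using n_pos pos_last[OF funpow_in] pos_funpow[of "n - 1"] by simp
  then show ?thesis using n_pos
    by (metis One_nat_def Suc_pred' comp_apply funpow.simps(2) less_eq_Suc_le)
qed

lemma preimage:
  assumes "y \<in> {1..n}"
  obtains x where "x \<in> {1..n}" "\<pi> x = y"
proof (cases "y = 1")
  case True
  have "p ((\<pi> ^^ (n - 1)) 1) = n - 1"
    using n_pos by (intro pos_funpow) simp
  then have "\<pi> ((\<pi> ^^ (n - 1)) 1) = y"
    using True n_pos by (intro trans[OF pos_last[OF funpow_in]]) simp_all
  then show ?thesis using that[OF funpow_in] by blast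
next
  case False
  then obtain k where "p y = Suc k"
    using pos_gt_0[OF assms] by (metis Suc_pred')
  then have "\<pi> ((\<pi> ^^ k) 1) = y"
    using funpow_pos[OF assms] by simp
  then show ?thesis using that[OF funpow_in] by blast
qed

lemma image_eq: "\<pi> ` {1..n} = {1..n}"
proof
  show "\<pi> ` {1..n} \<subseteq> {1..n}" by (rule image_subsetI) (rule maps)
  show "{1..n} \<subseteq> \<pi> ` {1..n}" by (rule subsetI) (metis preimage imageI)
qed

lemma inj: "inj_on \<pi> {1..n}"
  by (rule eq_card_imp_inj_on) (simp_all only: image_eq finite_atLeastAtMost)

lemma inj_iff: "x \<in> {1..n} \<Longrightarrow> y \<in> {1..n} \<Longrightarrow> \<pi> x = \<pi> y \<longleftrightarrow> x = y"
  using inj by (meson inj_on_eq_iff)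

lemma permutes: "\<pi> permutes {1..n}"
proof (rule bij_imp_permutes)
  show "bij_betw \<pi> {1..n} {1..n}" using inj image_eq unfolding bij_betw_def by blast
qed (rule outside)

lemma cyclic: "cyclic_on \<pi> {1..n}"
proof (rule cyclic_on_singleI)
  show "1 \<in> {1..n}" using n_pos by simp
  have "orbit \<pi> 1 = {(\<pi> ^^ m) 1 | m. m < n}"
    by (rule orbit_altdef_bounded) (use funpow_n n_pos in auto)
  also have "\<dots> = {1..n}" using funpow_image by auto
  finally show "{1..n} = orbit \<pi> 1" by simp
qed

end

text \<open>\<open>k\<close> is the first return time of \<open>1\<close>. The iterates before it
  enumerate the orbit once, and the orbit is all of \<open>{1..n}\<close>, so \<open>k = n\<close>;
  \<open>p\<close> inverts this enumeration.\<close>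

lemma cycle_positionI:
  assumes n: "1 \<le> n" and perm: "\<pi> permutes {1..n}" and cyc: "cyclic_on \<pi> {1..n}"
  shows "\<exists>p. cycle_position n \<pi> p"
proof -
  define k where "k = funpow_dist1 \<pi> 1 1"
  have orb: "orbit \<pi> 1 = {1..n}"
    using orbit_cyclic_eq3[OF cyc] n by simp
  then have self: "1 \<in> orbit \<pi> 1" using n by simp
  have im: "{1..n} = (\<lambda>i. (\<pi> ^^ i) 1) ` {0..<k}"
    using orbit_conv_funpow_dist1[OF self] orb by (simp add: k_def)
  have inj: "inj_on (\<lambda>i. (\<pi> ^^ i) 1) {0..<k}"
    using inj_on_funpow_dist1[OF self] by (simp add: k_def)
  have "card {1..n} = k" unfolding im card_image[OF inj] by simp
  then have "k = n" by simp
  have kn: "(\<pi> ^^ n) 1 = 1" using funpow_dist1_prop[OF self] unfolding k_def[symmetric] \<open>k = n\<close> .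
  define p where "p = inv_into {0..<n} (\<lambda>i. (\<pi> ^^ i) 1)"
  have p: "p ((\<pi> ^^ i) 1) = i" if "i < n" for i
    unfolding p_def using inj that \<open>k = n\<close> by (intro inv_into_f_f) auto
  have ex: "\<exists>i<n. x = (\<pi> ^^ i) 1" if "x \<in> {1..n}" for x
    using that unfolding im \<open>k = n\<close> by auto
  have "cycle_position n \<pi> p"
  proof
    show "p 1 = 0" using p[of 0] n by simp
    show "p x < n" if "x \<in> {1..n}" for x using ex[OF that] p by auto
    show "p (\<pi> x) = Suc (p x)" if x: "x \<in> {1..n}" "Suc (p x) < n" for x
    proof -
      obtain i where i: "i < n" "x = (\<pi> ^^ i) 1" using ex[OF x(1)] by blast
      then show ?thesis using p[of "Suc i"] p[of i] x(2) by simp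
    qed
    show "\<pi> x = 1" if x: "x \<in> {1..n}" "Suc (p x) = n" for x
    proof -
      obtain i where i: "i < n" "x = (\<pi> ^^ i) 1" using ex[OF x(1)] by blast
      then have "Suc i = n" using p[of i] x(2) by simp
      then have "\<pi> x = (\<pi> ^^ n) 1" using i by auto
      then show ?thesis using kn by simp
    qed
    show "\<pi> x \<in> {1..n}" if "x \<in> {1..n}" for x using permutes_in_image[OF perm] that by blast
    show "\<pi> x = x" if "x \<notin> {1..n}" for x using permutes_not_in[OF perm] that by blast
  qed (rule n)
  then show ?thesis by blast
qed

text \<open>Entries are distinct, so avoidance can be put as an implication with a strict
  conclusion. In \<open>av321\<close> the variables are elements of the cycle rather than indices,
  which lets it be combined with inequalities about \<open>\<pi>\<close>.\<close>

locale avoider = cycle_position +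
  assumes av213: "1 \<le> a \<Longrightarrow> a < b \<Longrightarrow> b < c \<Longrightarrow> c \<le> n \<Longrightarrow> \<pi> b < \<pi> a \<Longrightarrow> \<pi> c < \<pi> a"
    and av321: "1 \<le> z \<Longrightarrow> z < y \<Longrightarrow> y < x \<Longrightarrow> x \<le> n \<Longrightarrow> p x < p y \<Longrightarrow> p z < p y"

section \<open>Translating avoidance of lists into inequalities of values and positions\<close>

lemma nth_one_line: "i < n \<Longrightarrow> one_line n \<pi> ! i = \<pi> (Suc i)"
  by (simp add: one_line_def del: upt_Suc)

lemma length_one_line: "length (one_line n \<pi>) = n"
  by (simp add: one_line_def)

lemma (in cycle_position) avoids_213_iff:
  "avoids (one_line n \<pi>) [2,1,3] \<longleftrightarrow>
    (\<forall>a b c. 1 \<le> a \<longrightarrow> a < b \<longrightarrow> b < c \<longrightarrow> c \<le> n \<longrightarrow> \<pi> b < \<pi> a \<longrightarrow> \<pi> c < \<pi> a)" (is "?L \<longleftrightarrow> ?R")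
proof
  assume L: ?L
  show ?R
  proof (intro allI impI)
    fix a b c :: nat
    assume *: "1 \<le> a" "a < b" "b < c" "c \<le> n" "\<pi> b < \<pi> a"
    have "\<not> \<pi> a < \<pi> c"
    proof
      assume "\<pi> a < \<pi> c"
      then have "\<exists>a b c. a < b \<and> b < c \<and> c < length (one_line n \<pi>) \<and>
          one_line n \<pi> ! b < one_line n \<pi> ! a \<and> one_line n \<pi> ! a < one_line n \<pi> ! c"
        using * by (intro exI[of _ "a - 1"] exI[of _ "b - 1"] exI[of _ "c - 1"])
          (auto simp: nth_one_line length_one_line)
      then show False using L unfolding avoids_def contains_213_iff by blast
    qed
    moreover have "\<pi> a \<noteq> \<pi> c" using * inj_iff[of a c] by auto
    ultimately show "\<pi> c < \<pi> a" by linarith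
  qed
next
  assume R: ?R
  show ?L unfolding avoids_def contains_213_iff
  proof clarify
    fix a b c
    assume "a < b" "b < c" "c < length (one_line n \<pi>)"
      "one_line n \<pi> ! b < one_line n \<pi> ! a" "one_line n \<pi> ! a < one_line n \<pi> ! c"
    then show False
      using R[rule_format, of "Suc a" "Suc b" "Suc c"] by (auto simp: nth_one_line length_one_line)
  qed
qed

lemma (in cycle_position) avoids_321_iff:
  "avoids (cycle_notation n \<pi>) [3,2,1] \<longleftrightarrow>
    (\<forall>x y z. 1 \<le> z \<longrightarrow> z < y \<longrightarrow> y < x \<longrightarrow> x \<le> n \<longrightarrow> p x < p y \<longrightarrow> p z < p y)" (is "?L \<longleftrightarrow> ?R")
proof
  have nth: "cycle_notation n \<pi> ! p x = x" if "x \<in> {1..n}" for x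
    using pos_less[OF that] funpow_pos[OF that] by (simp add: cycle_notation_def)
  assume L: ?L
  show ?R
  proof (intro allI impI)
    fix x y z :: nat
    assume *: "1 \<le> z" "z < y" "y < x" "x \<le> n" "p x < p y"
    have "\<not> p y < p z"
    proof
      assume "p y < p z"
      then have "\<exists>a b c. a < b \<and> b < c \<and> c < length (cycle_notation n \<pi>) \<and>
          cycle_notation n \<pi> ! c < cycle_notation n \<pi> ! b \<and> cycle_notation n \<pi> ! b < cycle_notation n \<pi> ! a"
        using * pos_less[of z] by (intro exI[of _ "p x"] exI[of _ "p y"] exI[of _ "p z"])
          (auto simp: nth, simp add: cycle_notation_def)
      then show False using L unfolding avoids_def contains_321_iff by blast
    qed
    moreover have "p y \<noteq> p z" using * pos_eq_iff[of y z] by auto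
    ultimately show "p z < p y" by linarith
  qed
next
  assume R: ?R
  show ?L unfolding avoids_def contains_321_iff
  proof clarify
    fix a b c
    assume *: "a < b" "b < c" "c < length (cycle_notation n \<pi>)"
      "cycle_notation n \<pi> ! c < cycle_notation n \<pi> ! b"
      "cycle_notation n \<pi> ! b < cycle_notation n \<pi> ! a"
    have len: "length (cycle_notation n \<pi>) = n" by (simp add: cycle_notation_def)
    have nth: "cycle_notation n \<pi> ! i = (\<pi> ^^ i) 1" if "i < n" for i
      using that by (simp add: cycle_notation_def)
    show False
      using R[rule_format, of "(\<pi> ^^ c) 1" "(\<pi> ^^ b) 1" "(\<pi> ^^ a) 1"]
        * len nth pos_funpow funpow_in[of a] funpow_in[of c]
      by auto
  qed
qed

lemma cyc_avoiders_eq: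
  assumes "1 \<le> n"
  shows "cyc_avoiders n [2,1,3] [3,2,1] = {\<pi>. \<exists>p. avoider n \<pi> p}"
proof (intro set_eqI iffI)
  fix \<pi> assume "\<pi> \<in> cyc_avoiders n [2,1,3] [3,2,1]"
  then have *: "\<pi> permutes {1..n}" "cyclic_on \<pi> {1..n}"
    "avoids (one_line n \<pi>) [2,1,3]" "avoids (cycle_notation n \<pi>) [3,2,1]"
    by (auto simp: cyc_avoiders_def)
  obtain p where "cycle_position n \<pi> p"
    using cycle_positionI[OF assms *(1,2)] by blast
  then interpret cycle_position n \<pi> p .
  have "avoider n \<pi> p"
    using *(3,4) unfolding avoids_213_iff avoids_321_iff by unfold_locales blast+
  then show "\<pi> \<in> {\<pi>. \<exists>p. avoider n \<pi> p}" by blast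
next
  fix \<pi> assume "\<pi> \<in> {\<pi>. \<exists>p. avoider n \<pi> p}"
  then obtain p where "avoider n \<pi> p" by blast
  then interpret avoider n \<pi> p .
  have "avoids (one_line n \<pi>) [2,1,3]" "avoids (cycle_notation n \<pi>) [3,2,1]"
    unfolding avoids_213_iff avoids_321_iff using av213 av321 by blast+
  then show "\<pi> \<in> cyc_avoiders n [2,1,3] [3,2,1]"
    using permutes cyclic by (simp add: cyc_avoiders_def)
qed

subsection \<open>Four families of avoiders\<close>

text \<open>A sequence that splits into two increasing subsequences, here the colour classes of
  \<open>Q\<close>, avoids \<open>321\<close>.\<close>

lemma avoiderI:
  assumes "cycle_position n \<pi> p"
    and col: "\<And>x y. 1 \<le> x \<Longrightarrow> x < y \<Longrightarrow> y \<le> n \<Longrightarrow> Q x \<longleftrightarrow> Q y \<Longrightarrow> p x < p y"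
    and av213: "\<And>a b c. 1 \<le> a \<Longrightarrow> a < b \<Longrightarrow> b < c \<Longrightarrow> c \<le> n \<Longrightarrow> \<pi> b < \<pi> a \<Longrightarrow> \<pi> c < \<pi> a"
  shows "avoider n \<pi> p"
proof -
  interpret cycle_position n \<pi> p by fact
  show ?thesis
  proof
    fix x y z :: nat
    assume *: "1 \<le> z" "z < y" "y < x" "x \<le> n" "p x < p y"
    then have "Q x \<noteq> Q y" using col[of y x] by auto
    moreover have "p z < p x \<or> Q x \<noteq> Q z" using col[of z x] * by auto
    moreover have "p z < p y \<or> Q y \<noteq> Q z" using col[of z y] * by auto
    ultimately show "p z < p y" using * by auto
  qed (rule av213)
qed

text \<open>With \<open>m = n + 1 - j\<close>, the one-line notation is \<open>j, \<dots>, n | m + 2, \<dots>, j - 1 | 1 | 2, \<dots>, m + 1\<close>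
  and the cycle notation \<open>1, j, 2, j + 1, \<dots>, m, n, m + 1, m + 2, \<dots>, j - 1\<close>.\<close>

definition large_first :: "nat \<Rightarrow> nat \<Rightarrow> nat \<Rightarrow> nat" where
  "large_first n j x =
     (if x = 0 \<or> n < x then x
      else if x + j \<le> n + 1 then x + j - 1
      else if x + 1 < j then x + 1
      else if x < j then 1
      else x + 2 - j)"

text \<open>The elements below \<open>j\<close> and those from \<open>j\<close> on are each visited
  in increasing order. The bound \<open>n + 3 \<le> 2 * j\<close> means \<open>m < j - 1\<close>, so
  after the alternation a non-empty run \<open>m + 1, ..., j - 1\<close> closes the cycle.\<close>

lemma avoider_large_first:
  assumes "n + 3 \<le> 2 * j" "j \<le> n"
  shows "avoider n (large_first n j)
    (\<lambda>x. if x + j \<le> n + 1 then 2 * (x - 1) else if x < j then x + n - j else 2 * (x - j) + 1)"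
proof (rule avoiderI[where Q = "\<lambda>x. j \<le> x"])
  show "cycle_position n (large_first n j)
    (\<lambda>x. if x + j \<le> n + 1 then 2 * (x - 1) else if x < j then x + n - j else 2 * (x - j) + 1)"
    using assms by unfold_locales (auto simp: large_first_def split: if_splits)
next
  fix a b c
  assume "1 \<le> a" "a < b" "b < c" "c \<le> n" "large_first n j b < large_first n j a"
  then show "large_first n j c < large_first n j a"
    using assms unfolding large_first_def by (auto split: if_splits)
qed (use assms in auto)

text \<open>With \<open>m = n + 1 - j\<close>, the one-line notation is
  \<open>j | m + 2, \<dots>, n | j + 1, \<dots>, m + 1 | 2, \<dots>, j - 1 | 1\<close> and the cycle notation
  \<open>1, j, j + 1, \<dots>, m + 1, 2, m + 2, 3, m + 3, \<dots>, j - 1, n\<close>.\<close>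

definition medium_first :: "nat \<Rightarrow> nat \<Rightarrow> nat \<Rightarrow> nat" where
  "medium_first n j x =
     (if x = 0 \<or> n < x then x
      else if x = 1 then j
      else if x < j then x + (n + 1 - j)
      else if x + j \<le> n + 1 then x + 1
      else if x < n then x + j - n
      else 1)"

text \<open>The colour classes are again the elements below \<open>j\<close> and those from
  \<open>j\<close> on. The bound \<open>2 * j \<le> n + 2\<close> means
  \<open>j \<le> m + 1\<close>, so the run from \<open>j\<close> to \<open>m + 1\<close> is
  non-empty.\<close>

lemma avoider_medium_first:
  assumes "4 \<le> j" "2 * j \<le> n + 2"
  shows "avoider n (medium_first n j)
    (\<lambda>x. if x = 1 then 0 else if x < j then n + 2 * x - 2 * j
         else if x + j \<le> n + 2 then x + 1 - j else n + 5 - 2 * j + 2 * (x + j - n - 3))"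
proof (rule avoiderI[where Q = "\<lambda>x. j \<le> x"])
  show "cycle_position n (medium_first n j)
    (\<lambda>x. if x = 1 then 0 else if x < j then n + 2 * x - 2 * j
         else if x + j \<le> n + 2 then x + 1 - j else n + 5 - 2 * j + 2 * (x + j - n - 3))"
    using assms by unfold_locales (auto simp: medium_first_def split: if_splits)
next
  fix a b c
  assume "1 \<le> a" "a < b" "b < c" "c \<le> n" "medium_first n j b < medium_first n j a"
  then show "medium_first n j c < medium_first n j a"
    using assms unfolding medium_first_def by (auto split: if_splits)
qed (use assms in auto)

text \<open>With \<open>m = n + 1 - j\<close>, the one-line notation is
  \<open>j | m + 3, \<dots>, n | j + 1, \<dots>, t + 1 | m + 2 | t + 2, \<dots>, m + 1 | 1, \<dots>, j - 1\<close>. It is cyclic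
  only for \<open>t = j + 2 * d\<close>, with the cycle notation \<open>1, j, j + 2, \<dots>, t, m + 2, 2, m + 3, 3, \<dots>, n,
  j - 1, j + 1, \<dots>, t - 1, t + 1, t + 2, \<dots>, m + 1\<close>.\<close>

definition small_last :: "nat \<Rightarrow> nat \<Rightarrow> nat \<Rightarrow> nat \<Rightarrow> nat" where
  "small_last n j t x =
     (if x = 0 \<or> n < x then x
      else if x = 1 then j
      else if x + 1 < j then x + n + 2 - j
      else if x < t then x + 2
      else if x = t then n + 3 - j
      else if x + j \<le> n + 1 then x + 1
      else x + j - (n + 1))"

text \<open>The last two branches are the parity classes of \<open>{j - 1..j + 2 * d}\<close>: that
  of \<open>j\<close> directly follows \<open>1\<close>, that of \<open>j - 1\<close> comes once all
  smaller elements and all elements above \<open>m + 1\<close> have been visited.\<close>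

definition small_last_pos :: "nat \<Rightarrow> nat \<Rightarrow> nat \<Rightarrow> nat \<Rightarrow> nat" where
  "small_last_pos n j d x =
     (if x = 1 then 0
      else if n + 3 \<le> x + j then 2 + d + 2 * (x + j - (n + 3))
      else if x + 1 < j then 3 + d + 2 * (x - 2)
      else if j + 2 * d < x then 2 * d + 2 * j + (x - (j + 2 * d)) - 3
      else if even (x - (j - 1)) then d + 2 * j - 3 + (x - (j - 1)) div 2
      else 1 + (x - j) div 2)"

lemma avoider_small_last:
  assumes j: "3 \<le> j" and jd: "2 * j + 2 * d \<le> n + 1"
  shows "avoider n (small_last n j (j + 2 * d)) (small_last_pos n j d)"
proof (rule avoiderI)
  let ?\<pi> = "small_last n j (j + 2 * d)" and ?p = "small_last_pos n j d"
  \<comment> \<open>The two parity classes get an explicit parameter \<open>i\<close>, which makes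
    the position formulas \<open>p5\<close> and \<open>p6\<close> linear.\<close>
  have cases: thesis
    if "1 \<le> x" "x \<le> n"
      and "x = 1 \<Longrightarrow> thesis"
      and "n + 3 \<le> x + j \<Longrightarrow> thesis"
      and "2 \<le> x \<Longrightarrow> x + 1 < j \<Longrightarrow> thesis"
      and "j + 2 * d < x \<Longrightarrow> x + j \<le> n + 2 \<Longrightarrow> thesis"
      and "\<And>i. i \<le> d \<Longrightarrow> x = j - 1 + 2 * i \<Longrightarrow> thesis"
      and "\<And>i. i \<le> d \<Longrightarrow> x = j + 2 * i \<Longrightarrow> thesis"
    for x thesis
  proof (cases "j - 1 \<le> x \<and> x \<le> j + 2 * d")
    case True
    show ?thesis
    proof (cases "even (x - (j - 1))")
      case even: True
      then obtain i where "x - (j - 1) = 2 * i" by (elim evenE)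
      then show ?thesis using True j by (intro that(7)[of i]) linarith+
    next
      case odd: False
      then obtain i where "x - (j - 1) = 2 * i + 1" by (elim oddE)
      then show ?thesis using True j by (intro that(8)[of i]) linarith+
    qed
  qed (use that in linarith)
  have p1: "?p 1 = 0"
    by (simp add: small_last_pos_def)
  have p2: "?p x = 2 + d + 2 * (x + j - (n + 3))" if "n + 3 \<le> x + j" for x
    using that j jd by (simp add: small_last_pos_def)
  have p3: "?p x = 3 + d + 2 * (x - 2)" if "2 \<le> x" "x + 1 < j" for x
    using that j jd by (simp add: small_last_pos_def)
  have p4: "?p x = 2 * d + 2 * j + (x - (j + 2 * d)) - 3" if "j + 2 * d < x" "x + j \<le> n + 2" for x
    using that j jd by (simp add: small_last_pos_def)
  have p5: "?p (j - 1 + 2 * i) = d + 2 * j - 3 + i" if "i \<le> d" for i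
  proof -
    obtain h where "j = h + 3" using j by (metis le_Suc_ex add.commute)
    then show ?thesis using that jd by (simp add: small_last_pos_def)
  qed
  have p6: "?p (j + 2 * i) = 1 + i" if "i \<le> d" for i
    using that j jd by (simp add: small_last_pos_def)
  show "cycle_position n ?\<pi> ?p"
  proof
    fix x assume x: "x \<in> {1..n}"
    then have x1: "1 \<le> x" "x \<le> n" by auto
    show "?\<pi> x \<in> {1..n}"
      using assms x by (auto simp: small_last_def)
    show "?p x < n"
      using x1 by (cases rule: cases) (use p1 p2 p3 p4 p5 p6 j jd x1 in auto)
    show "?p (?\<pi> x) = Suc (?p x)" if less: "Suc (?p x) < n"
      using x1
    proof (cases rule: cases)
      assume "x = 1"
      then show ?thesis using p1 p6[of 0] j jd by (simp add: small_last_def)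
    next
      assume *: "n + 3 \<le> x + j"
      then have \<pi>: "?\<pi> x = x + j - (n + 1)" using x1 j jd by (simp add: small_last_def)
      show ?thesis
      proof (cases "x = n")
        case True
        then show ?thesis using p5[of 0] p2[OF *] \<pi> j by simp
      next
        case False
        then show ?thesis using p3[of "x + j - (n + 1)"] p2[OF *] * \<pi> x1 by simp
      qed
    next
      assume *: "2 \<le> x" "x + 1 < j"
      then have "?\<pi> x = x + n + 2 - j" using x1 j jd by (simp add: small_last_def)
      then show ?thesis using p2[of "x + n + 2 - j"] p3[OF *] * j jd by simp
    next
      assume *: "j + 2 * d < x" "x + j \<le> n + 2"
      then have "x + j \<noteq> n + 2" using less p4[OF *] by auto
      then have "?\<pi> x = x + 1" using * x1 j jd by (simp add: small_last_def)
      then show ?thesis using p4[of "x + 1"] p4[OF *] * j \<open>x + j \<noteq> n + 2\<close> by simp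
    next
      fix i assume *: "i \<le> d" "x = j - 1 + 2 * i"
      then have "x \<noteq> 1" "j \<le> x + 1" "x < j + 2 * d" using j by linarith+
      then have \<pi>: "?\<pi> x = x + 2" using x1 by (simp add: small_last_def)
      have px: "?p x = d + 2 * j - 3 + i" using p5[OF *(1)] *(2) by simp
      show ?thesis
      proof (cases "i = d")
        case True
        \<comment> \<open>From \<open>t - 1\<close> the step of 2 jumps over \<open>t\<close> to
          \<open>t + 1\<close>, where the closing run of consecutive elements begins.\<close>
        then have x2: "x + 2 = j + 2 * d + 1" using * j by linarith
        then have "?p (x + 2) = 2 * d + 2 * j + (x + 2 - (j + 2 * d)) - 3"
          using j jd by (intro p4) linarith+
        then show ?thesis using True j px x2 by (simp only: \<pi>)
      next
        case False
        then have "?p (j - 1 + 2 * Suc i) = d + 2 * j - 3 + Suc i" using * by (intro p5) simp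
        moreover have "j - 1 + 2 * Suc i = x + 2" using *(2) by simp
        ultimately show ?thesis using px \<pi> by simp
      qed
    next
      fix i assume *: "i \<le> d" "x = j + 2 * i"
      show ?thesis
      proof (cases "i = d")
        case True
        then have "?\<pi> x = n + 3 - j" using * j jd by (simp add: small_last_def)
        then show ?thesis using p2[of "n + 3 - j"] p6[OF *(1)] * True j jd by simp
      next
        case False
        then have "?\<pi> x = j + 2 * Suc i" using * j jd by (simp add: small_last_def)
        then show ?thesis using p6[of "Suc i"] p6[OF *(1)] * False by simp
      qed
    qed
    show "?\<pi> x = 1" if last: "Suc (?p x) = n"
    proof -
      have "x + j = n + 2"
        using x1 by (cases rule: cases) (use p1 p2 p3 p4 p5 p6 j jd x1 last in auto)
      then show ?thesis using j jd by (simp add: small_last_def)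
    qed
  qed (use assms p1 in \<open>auto simp: small_last_def\<close>)
  \<comment> \<open>The two increasing subsequences of the cycle are
    \<open>j, j + 2, ..., t, m + 2, ..., n\<close> and the rest.\<close>
  let ?Q = "\<lambda>x. n + 3 \<le> x + j \<or> (\<exists>i\<le>d. x = j + 2 * i)"
  show "?p x < ?p y" if *: "1 \<le> x" "x < y" "y \<le> n" and Q: "?Q x \<longleftrightarrow> ?Q y" for x y
  proof (cases "?Q x")
    case True
    then show ?thesis using Q * p2[of x] p2[of y] p6 j jd by auto
  next
    case False
    then have nQ: "\<not> ?Q x" "\<not> ?Q y" using Q by auto
    have x: "1 \<le> x" "x \<le> n" and y: "1 \<le> y" "y \<le> n" using * by auto
    from x show ?thesis
    proof (cases rule: cases)
      assume xc: "x = 1"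
      show ?thesis
        by (rule cases[OF y]) (use xc p1 p2 p3 p4 p5 p6 j jd * in auto)
    next
      assume xc: "2 \<le> x" "x + 1 < j"
      show ?thesis
        by (rule cases[OF y]) (use xc p3[of x] p2 p3[of y] p4[of y] p5 p6 j jd * nQ in auto)
    next
      assume xc: "j + 2 * d < x" "x + j \<le> n + 2"
      show ?thesis
        by (rule cases[OF y]) (use xc p4[of x] p4[of y] j jd * nQ in auto)
    next
      fix i assume xc: "i \<le> d" "x = j - 1 + 2 * i"
      show ?thesis
        by (rule cases[OF y]) (use xc p4[of y] p5 j jd * nQ in auto)
    qed (use nQ in auto)
  qed
  show "?\<pi> c < ?\<pi> a" if "1 \<le> a" "a < b" "b < c" "c \<le> n" "?\<pi> b < ?\<pi> a" for a b c
    using that assms unfolding small_last_def by (auto split: if_splits)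
qed

text \<open>The one-line notation is \<open>3 | 4, \<dots>, t + 1 | n | t + 2, \<dots>, n - 1 | 2 | 1\<close>. It is cyclic only for
  \<open>t = 2 * s\<close>, with the cycle notation \<open>1, 3, \<dots>, t + 1, t + 2, \<dots>, n - 1, 2, 4, \<dots>, t, n\<close>.\<close>

definition three_first :: "nat \<Rightarrow> nat \<Rightarrow> nat \<Rightarrow> nat" where
  "three_first n t x =
     (if x = 0 \<or> n < x then x
      else if x = 1 then 3
      else if x = t then n
      else if x = n then 1
      else if x = n - 1 then 2
      else if x < t then x + 2
      else x + 1)"

definition three_first_pos :: "nat \<Rightarrow> nat \<Rightarrow> nat \<Rightarrow> nat" where
  "three_first_pos n s x =
     (if x = n then n - 1
      else if 2 * s < x then x - s - 1
      else if even x then n - 2 - s + x div 2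
      else x div 2)"

lemma avoider_three_first:
  assumes s: "1 \<le> s" and sn: "2 * s + 2 \<le> n"
  shows "avoider n (three_first n (2 * s)) (three_first_pos n s)"
proof (rule avoiderI)
  let ?\<pi> = "three_first n (2 * s)" and ?p = "three_first_pos n s"
  have cases: thesis
    if "1 \<le> x" "x \<le> n"
      and "x = n \<Longrightarrow> thesis"
      and "2 * s < x \<Longrightarrow> x < n \<Longrightarrow> thesis"
      and "\<And>i. 1 \<le> i \<Longrightarrow> i \<le> s \<Longrightarrow> x = 2 * i \<Longrightarrow> thesis"
      and "\<And>i. i < s \<Longrightarrow> x = 2 * i + 1 \<Longrightarrow> thesis"
    for x thesis
  proof (cases "x \<le> 2 * s")
    case True
    show ?thesis
    proof (cases "even x")
      case even: True
      then obtain i where "x = 2 * i" by (elim evenE)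
      then show ?thesis using True \<open>1 \<le> x\<close> by (intro that(5)[of i]) linarith+
    next
      case odd: False
      then obtain i where "x = 2 * i + 1" by (elim oddE)
      then show ?thesis using True by (intro that(6)[of i]) linarith+
    qed
  qed (use that in linarith)
  have p1: "?p n = n - 1"
    by (simp add: three_first_pos_def)
  have p2: "?p x = x - s - 1" if "2 * s < x" "x < n" for x
    using that by (simp add: three_first_pos_def)
  have p3: "?p (2 * i) = n - 2 - s + i" if "i \<le> s" for i
    using that sn by (simp add: three_first_pos_def)
  have p4: "?p (2 * i + 1) = i" if "i < s" for i
    using that sn by (simp add: three_first_pos_def)
  show "cycle_position n ?\<pi> ?p"
  proof
    fix x assume x: "x \<in> {1..n}"
    then have x1: "1 \<le> x" "x \<le> n" by auto
    show "?\<pi> x \<in> {1..n}"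
      using assms x by (auto simp: three_first_def)
    show "?p x < n"
      by (rule cases[OF x1]) (use p1 p2 p3 p4 s sn x1 in auto)
    show "?p (?\<pi> x) = Suc (?p x)" if less: "Suc (?p x) < n"
    proof (rule cases[OF x1])
      assume "x = n"
      then show ?thesis using less p1 by simp
    next
      assume *: "2 * s < x" "x < n"
      show ?thesis
      proof (cases "x = n - 1")
        case True
        then have "?\<pi> x = 2 * 1" using * s sn by (auto simp: three_first_def)
        then show ?thesis using p2[OF *] True p3[OF s] * s sn by simp
      next
        case False
        then have "?\<pi> x = x + 1" using * s sn by (auto simp: three_first_def)
        then show ?thesis using p2[OF *] p2[of "x + 1"] False * s sn by simp
      qed
    next
      fix i assume *: "1 \<le> i" "i \<le> s" "x = 2 * i"
      show ?thesis
      proof (cases "i = s")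
        case True
        then have "?\<pi> x = n" using * sn by (auto simp: three_first_def)
        then show ?thesis using p1 p3[of i] True * sn by simp
      next
        case False
        then have "?\<pi> x = 2 * (i + 1)" using * sn by (auto simp: three_first_def)
        then show ?thesis using p3[of i] p3[of "i + 1"] False * by simp
      qed
    next
      fix i assume *: "i < s" "x = 2 * i + 1"
      then have \<pi>: "?\<pi> x = 2 * (i + 1) + 1" using sn by (auto simp: three_first_def)
      show ?thesis
      proof (cases "i + 1 = s")
        case True
        then show ?thesis using p2[of "2 * (i + 1) + 1"] p4[of i] * sn \<pi> by simp
      next
        case False
        then show ?thesis using p4[of i] p4[of "i + 1"] * \<pi> by simp
      qed
    qed
    show "?\<pi> x = 1" if last: "Suc (?p x) = n"
    proof -
      have "x = n"
        by (rule cases[OF x1]) (use p1 p2 p3 p4 s sn x1 last in auto)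
      then show ?thesis using s sn by (auto simp: three_first_def)
    qed
  qed (use assms p4[of 0] in \<open>auto simp: three_first_def\<close>)
  \<comment> \<open>\<open>2, 4, ..., 2 * s, n\<close> ends the cycle, and what precedes it
    increases as well.\<close>
  let ?Q = "\<lambda>x. x = n \<or> x \<le> 2 * s \<and> even x"
  show "?p x < ?p y" if *: "1 \<le> x" "x < y" "y \<le> n" and Q: "?Q x \<longleftrightarrow> ?Q y" for x y
  proof -
    have x: "1 \<le> x" "x \<le> n" and y: "1 \<le> y" "y \<le> n" using * by auto
    show ?thesis
    proof (rule cases[OF x])
      assume "x = n"
      then show ?thesis using * by simp
    next
      assume xc: "2 * s < x" "x < n"
      show ?thesis
        by (rule cases[OF y]) (use xc Q * p2[of x] p2[of y] in auto)
    next
      fix i assume xc: "1 \<le> i" "i \<le> s" "x = 2 * i"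
      show ?thesis
        by (rule cases[OF y]) (use xc Q * p1 p3 sn in auto)
    next
      fix i assume xc: "i < s" "x = 2 * i + 1"
      show ?thesis
        by (rule cases[OF y]) (use xc Q * p4 p2[of y] sn in auto)
    qed
  qed
  show "?\<pi> c < ?\<pi> a" if "1 \<le> a" "a < b" "b < c" "c \<le> n" "?\<pi> b < ?\<pi> a" for a b c
    using that assms unfolding three_first_def by (auto split: if_splits)
qed

subsection \<open>Avoiders whose first value is at least 3\<close>

lemma strict_mono_on_interval_ge:
  fixes f :: "nat \<Rightarrow> nat"
  assumes "strict_mono_on {a..b} f" "a \<le> x" "x \<le> y" "y \<le> b"
  shows "f x + (y - x) \<le> f y"
  using assms(3,4)
proof (induction y rule: dec_induct)
  case (step y)
  then have "f y < f (Suc y)"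
    using assms(1,2) by (intro strict_mono_onD[OF assms(1)]) auto
  then show ?case using step by simp
qed simp

text \<open>Strict growth has no slack when the interval and the range of allowed values are equally
  long.\<close>

lemma strict_mono_on_interval_eq:
  fixes f :: "nat \<Rightarrow> nat"
  assumes "strict_mono_on {a..b} f" "c \<le> f a" "f b \<le> c + (b - a)" "a \<le> x" "x \<le> b"
  shows "f x = c + (x - a)"
  using strict_mono_on_interval_ge[OF assms(1), of a x]
    strict_mono_on_interval_ge[OF assms(1), of x b] assms(2-5) by simp

text \<open>For \<open>x < t\<close> the value \<open>x + 2\<close> can only come from
  \<open>x\<close> or \<open>x + 1\<close>, since smaller arguments are used up and larger ones
  exceed it. Were it taken at \<open>x + 1\<close>, then \<open>f x > x + 2\<close>, and
  \<open>x, x + 1, t\<close> would form a \<open>213\<close> because \<open>f t = N\<close> is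
  maximal. Beyond \<open>t\<close> the value \<open>x + 1\<close> has no argument left but
  \<open>x\<close>.\<close>

lemma excedances_avoiding_213:
  fixes f :: "nat \<Rightarrow> nat"
  assumes exc: "\<And>x. a \<le> x \<Longrightarrow> x \<le> m \<Longrightarrow> x < f x"
    and low: "\<And>x. a \<le> x \<Longrightarrow> x \<le> m \<Longrightarrow> a + 2 \<le> f x"
    and upp: "\<And>x. a \<le> x \<Longrightarrow> x \<le> m \<Longrightarrow> f x \<le> N"
    and N: "m + 2 \<le> N"
    and surj: "\<And>v. a + 2 \<le> v \<Longrightarrow> v \<le> m + 1 \<or> v = N \<Longrightarrow> \<exists>x. a \<le> x \<and> x \<le> m \<and> f x = v"
    and inj: "inj_on f {a..m}"
    and av: "\<And>u v w. a \<le> u \<Longrightarrow> u < v \<Longrightarrow> v < w \<Longrightarrow> w \<le> m \<Longrightarrow> f v < f u \<Longrightarrow> f w < f u"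
    and "a \<le> m"
  shows "\<exists>t. a \<le> t \<and> t \<le> m \<and> f t = N \<and> (\<forall>x. a \<le> x \<longrightarrow> x < t \<longrightarrow> f x = x + 2) \<and>
    (\<forall>x. t < x \<longrightarrow> x \<le> m \<longrightarrow> f x = x + 1)"
proof -
  have eqD: "x = y" if "f x = f y" "a \<le> x" "x \<le> m" "a \<le> y" "y \<le> m" for x y
    using inj that by (auto dest: inj_onD)
  obtain t where t: "a \<le> t" "t \<le> m" "f t = N"
    using surj[of N] N \<open>a \<le> m\<close> by auto
  have less: "f x = x + 2" if "a \<le> x" "x < t" for x
    using that
  proof (induction x rule: less_induct)
    case (less x)
    obtain y where y: "a \<le> y" "y \<le> m" "f y = x + 2"
      using surj[of "x + 2"] less.prems t by auto
    have "\<not> y < x" using less.IH[of y] less.prems y by auto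
    moreover have "y < x + 2" using exc[of y] y by simp
    ultimately consider "y = x" | "y = x + 1" by linarith
    then show ?case
    proof cases
      case 1
      then show ?thesis using y by simp
    next
      case 2
      then have "f (x + 1) = x + 2" using y by simp
      then have "x + 1 \<noteq> t" using t N less.prems by auto
      have "f x \<noteq> x + 2"
        using eqD[of x y] y 2 less.prems by auto
      \<comment> \<open>The value \<open>x + 1\<close> is excluded by \<open>low\<close> if
        \<open>x = a\<close>, and otherwise already taken at \<open>x - 1\<close>.\<close>
      have "f x \<noteq> x + 1"
      proof
        assume fx: "f x = x + 1"
        then have "a < x" using low[of x] less.prems t by simp
        have "f (x - 1) = x - 1 + 2"
          using \<open>a < x\<close> less.prems by (intro less.IH) auto
        then have "f (x - 1) = f x" using fx \<open>a < x\<close> by linarith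
        then have "x - 1 = x"
          by (rule eqD) (use \<open>a < x\<close> less.prems t in auto)
        then show False using \<open>a < x\<close> by simp
      qed
      then have "f (x + 1) < f x"
        using exc[of x] \<open>f x \<noteq> x + 2\<close> \<open>f (x + 1) = x + 2\<close> less.prems t by simp
      then have "f t < f x"
        using av[of x "x + 1" t] less.prems \<open>x + 1 \<noteq> t\<close> t by simp
      then show ?thesis using upp[of x] less.prems t by simp
    qed
  qed
  have greater: "f x = x + 1" if "t < x" "x \<le> m" for x
    using that
  proof (induction x rule: less_induct)
    case (less x)
    obtain y where y: "a \<le> y" "y \<le> m" "f y = x + 1"
      using surj[of "x + 1"] less.prems t by auto
    have "\<not> (t < y \<and> y < x)" using less.IH[of y] y less.prems by auto
    moreover have "\<not> y < t" using \<open>\<And>x. a \<le> x \<Longrightarrow> x < t \<Longrightarrow> f x = x + 2\<close>[of y] y less.prems by auto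
    moreover have "y \<noteq> t" using y t N less.prems by auto
    moreover have "y < x + 1" using exc[of y] y by simp
    ultimately have "y = x" by linarith
    then show ?case using y by simp
  qed
  show ?thesis using t less greater by blast
qed

section \<open>What the first entry \<open>j\<close> forces\<close>

lemma (in cycle_position) pos_of_preimage_1:
  assumes "1 \<le> x" "x \<le> n" "\<pi> x = 1"
  shows "Suc (p x) = n"
proof (rule ccontr)
  assume "Suc (p x) \<noteq> n"
  then have "p (\<pi> x) = Suc (p x)"
    using assms pos_less[of x] by (intro pos_step) auto
  then show False using assms pos_1 by simp
qed

locale avoider_first = avoider +
  fixes j :: nat
  assumes first: "\<pi> 1 = j"
    and j_ge: "3 \<le> j"
begin

lemma j_le: "j \<le> n"
  using maps[of 1] n_pos first by auto

lemma maps': "1 \<le> x \<Longrightarrow> x \<le> n \<Longrightarrow> 1 \<le> \<pi> x \<and> \<pi> x \<le> n"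
  using maps[of x] by auto

lemma pre:
  assumes "1 \<le> y" "y \<le> n"
  obtains x where "1 \<le> x" "x \<le> n" "\<pi> x = y"
  using preimage[of y] assms by (metis atLeastAtMost_iff)

lemma inj': "1 \<le> x \<Longrightarrow> x \<le> n \<Longrightarrow> 1 \<le> y \<Longrightarrow> y \<le> n \<Longrightarrow> \<pi> x = \<pi> y \<Longrightarrow> x = y"
  using inj_iff[of x y] by auto

lemma pos_inj: "1 \<le> x \<Longrightarrow> x \<le> n \<Longrightarrow> 1 \<le> y \<Longrightarrow> y \<le> n \<Longrightarrow> p x = p y \<Longrightarrow> x = y"
  using pos_eq_iff[of x y] by auto

lemma pos_image': "1 \<le> x \<Longrightarrow> x \<le> n \<Longrightarrow> \<pi> x \<noteq> 1 \<Longrightarrow> p (\<pi> x) = Suc (p x)"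
  using pos_image[of x] by auto

lemma pos_less': "1 \<le> x \<Longrightarrow> x \<le> n \<Longrightarrow> p x < n"
  using pos_less[of x] by auto

text \<open>After the first entry \<open>j\<close>, a value below \<open>j\<close> followed by one
  above it would form a \<open>213\<close>. So the \<open>j - 1\<close> places with smaller values
  are closed upwards, hence are the last \<open>j - 1\<close> places.\<close>

lemma image_less_iff:
  assumes "1 \<le> x" "x \<le> n"
  shows "\<pi> x < j \<longleftrightarrow> n + 1 < x + j"
proof -
  define L where "L = {y \<in> {1..n}. \<pi> y < j}"
  have "\<pi> ` L = {1..<j}"
  proof
    show "\<pi> ` L \<subseteq> {1..<j}" using maps' by (auto simp: L_def)
    show "{1..<j} \<subseteq> \<pi> ` L"
    proof
      fix y assume "y \<in> {1..<j}"
      then show "y \<in> \<pi> ` L"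
        using pre[of y] j_le by (auto simp: L_def)
    qed
  qed
  moreover have "inj_on \<pi> L"
    by (rule inj_onI) (auto simp: L_def intro: inj')
  ultimately have card: "card L = j - 1"
    by (metis card_image card_atLeastLessThan)
  have fin: "finite L" by (simp add: L_def)
  have up: "z \<in> L" if "y \<in> L" "y \<le> z" "z \<le> n" for y z
  proof (cases "y = z")
    case False
    have "y \<noteq> 1" using that first by (auto simp: L_def)
    then have "\<pi> z < \<pi> 1"
      using that False first by (intro av213[of 1 y z]) (auto simp: L_def)
    then show ?thesis using that first by (auto simp: L_def)
  qed (use that in simp)
  show ?thesis
  proof (cases "x \<in> L")
    case True
    then have "{x..n} \<subseteq> L" using up by auto
    then have "card {x..n} \<le> card L" using fin card_mono by blast
    then show ?thesis using card True assms j_ge by (auto simp: L_def)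
  next
    case False
    then have "L \<subseteq> {x<..n}"
      using up[of _ x] assms by (force simp: L_def)
    then have "card L \<le> card {x<..n}" by (intro card_mono) auto
    then show ?thesis using card False assms j_ge by (auto simp: L_def)
  qed
qed

lemma pos_j: "p j = 1"
  using pos_image'[of 1] first pos_1 n_pos j_ge by simp

lemma pos_mono:
  assumes "1 \<le> x" "x < y" "y < j"
  shows "p x < p y"
proof -
  have y: "0 < p y" using pos_gt_0[of y] assms j_le by simp
  show ?thesis
  proof (cases "x = 1")
    case True
    then show ?thesis using y pos_1 by simp
  next
    case False
    have "p y \<noteq> p j" using pos_inj[of y j] assms j_le by auto
    then have "p j < p y" using y pos_j by simp
    then show ?thesis using av321[of x y j] assms j_le by simp
  qed
qed

lemma pos_mono_le: "1 \<le> x \<Longrightarrow> x \<le> y \<Longrightarrow> y < j \<Longrightarrow> p x \<le> p y"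
  using pos_mono[of x y] by (cases "x = y") auto

lemma pos_less_imp: "1 \<le> x \<Longrightarrow> x < j \<Longrightarrow> 1 \<le> y \<Longrightarrow> y < j \<Longrightarrow> p x < p y \<Longrightarrow> x < y"
  using pos_mono_le[of y x] by (meson leD leI)

text \<open>The elements below \<open>j\<close> occur in increasing order in the cycle, so two
  adjacent ones are consecutive numbers; only after the last of them, \<open>j - 1\<close>, can the
  cycle return to \<open>1\<close>.\<close>

lemma next_small:
  assumes x: "1 \<le> x" "x < j" and small: "\<pi> x < j"
  shows "\<pi> x = (if x + 1 < j then x + 1 else 1)"
proof (cases "\<pi> x = 1")
  case True
  then have "Suc (p x) = n" using pos_of_preimage_1[of x] x j_le by simp
  then have "\<not> x + 1 < j"
    using pos_mono[of x "x + 1"] pos_less'[of "x + 1"] x j_le by auto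
  then show ?thesis using True by simp
next
  case False
  have p: "p (\<pi> x) = Suc (p x)" using False x j_le by (intro pos_image') auto
  have "1 \<le> \<pi> x" using maps'[of x] x j_le by simp
  then have "x < \<pi> x" using pos_less_imp[of x "\<pi> x"] x small p by simp
  moreover have "\<not> x + 1 < \<pi> x"
    using pos_mono[of x "x + 1"] pos_mono[of "x + 1" "\<pi> x"] x small p by auto
  ultimately show ?thesis using small by simp
qed

text \<open>The only place between \<open>x\<close> and \<open>\<pi> (\<pi> x)\<close> is held by
  \<open>\<pi> x\<close>, which is not small, so the two are still successive among the small
  elements.\<close>

lemma next_next_small:
  assumes x: "1 \<le> x" "x < j" and large: "j \<le> \<pi> x" and small: "\<pi> (\<pi> x) < j"
  shows "\<pi> (\<pi> x) = (if x + 1 < j then x + 1 else 1)"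
proof -
  have px: "p (\<pi> x) = Suc (p x)" using x j_le large j_ge by (intro pos_image') auto
  have \<pi>x: "1 \<le> \<pi> x" "\<pi> x \<le> n" using maps'[of x] x j_le by auto
  have neq: "p (x + 1) \<noteq> Suc (p x)" if "x + 1 < j"
    using pos_inj[of "x + 1" "\<pi> x"] \<pi>x that large j_le px by auto
  show ?thesis
  proof (cases "\<pi> (\<pi> x) = 1")
    case True
    then have "Suc (Suc (p x)) = n" using pos_of_preimage_1[of "\<pi> x"] \<pi>x px by simp
    then have "\<not> x + 1 < j"
      using pos_mono[of x "x + 1"] pos_less'[of "x + 1"] x j_le neq by auto
    then show ?thesis using True by simp
  next
    case False
    have p: "p (\<pi> (\<pi> x)) = Suc (Suc (p x))" using False \<pi>x px by (simp add: pos_image')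
    have "1 \<le> \<pi> (\<pi> x)" using maps' \<pi>x by simp
    then have "x < \<pi> (\<pi> x)" using pos_less_imp[of x "\<pi> (\<pi> x)"] x small p by simp
    moreover have "\<not> x + 1 < \<pi> (\<pi> x)"
      using pos_mono[of x "x + 1"] pos_mono[of "x + 1" "\<pi> (\<pi> x)"] x small p neq by auto
    ultimately show ?thesis using small by simp
  qed
qed

end

section \<open>Large first entry: \<open>n + 2 \<le> 2 * j\<close>\<close>

context avoider_first
begin

text \<open>Here \<open>m < j\<close>, so every element from \<open>j\<close> on has an image below
  \<open>j\<close>: large elements are isolated in the cycle, and \<open>next_next_small\<close>
  gives \<open>\<pi> (\<pi> x)\<close>. Only the order of the values on \<open>{1..m}\<close> is
  open, and it turns out to be increasing.\<close>

lemma classify_large: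
  assumes A: "n + 2 \<le> 2 * j"
  shows "n + 3 \<le> 2 * j \<and> \<pi> = large_first n j \<or>
    4 \<le> j \<and> 2 * j = n + 2 \<and> \<pi> = medium_first n j \<or>
    n = 4 \<and> \<pi> = three_first n 2"
proof -
  let ?m = "n + 1 - j"
  have m: "1 \<le> ?m" "?m < j" "?m + j = n + 1" using j_le A by auto
  have large: "j \<le> \<pi> x" if "1 \<le> x" "x \<le> ?m" for x
    using image_less_iff[of x] that m by auto
  have nn: "\<pi> (\<pi> x) = (if x + 1 < j then x + 1 else 1)" if x: "1 \<le> x" "x \<le> ?m" for x
  proof (rule next_next_small)
    have "1 \<le> \<pi> x" "\<pi> x \<le> n" using maps'[of x] x m j_le by auto
    then show "\<pi> (\<pi> x) < j" using image_less_iff[of "\<pi> x"] large[OF x] A by simp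
  qed (use x m large in auto)
  \<comment> \<open>If \<open>\<pi> y < \<pi> x\<close>, the cycle has \<open>\<pi> x\<close> before
    \<open>\<pi> y\<close>, which is directly before \<open>y + 1\<close>: a \<open>321\<close>,
    since \<open>y + 1 < j \<le> \<pi> y\<close>.\<close>
  have mono1: "\<pi> x < \<pi> y" if xy: "1 \<le> x" "x < y" "y \<le> ?m" "y + 1 < j" for x y
  proof (rule ccontr)
    assume "\<not> \<pi> x < \<pi> y"
    moreover have "\<pi> x \<noteq> \<pi> y" using inj'[of x y] xy m j_le by auto
    ultimately have gt: "\<pi> y < \<pi> x" by simp
    have "\<pi> x \<noteq> 1" "\<pi> y \<noteq> 1" using large[of x] large[of y] xy j_ge by auto
    then have px: "p (\<pi> x) = Suc (p x)" and py: "p (\<pi> y) = Suc (p y)"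
      using xy m j_le by (auto intro!: pos_image')
    have le: "\<pi> x \<le> n" "1 \<le> \<pi> y" "\<pi> y \<le> n" using maps' xy m j_le by auto
    have "\<pi> (\<pi> y) = y + 1" using nn[of y] xy by simp
    then have "p (y + 1) = Suc (p (\<pi> y))" using pos_image'[of "\<pi> y"] le xy by auto
    moreover have "p (y + 1) < p (\<pi> y)"
      using gt le xy large[of y] px py pos_mono[of x y] by (intro av321[of "y + 1" "\<pi> y" "\<pi> x"]) auto
    ultimately show False by simp
  qed
  have mono: "strict_mono_on {1..?m} \<pi>"
  proof (rule strict_mono_onI)
    fix x y assume xy: "x \<in> {1..?m}" "y \<in> {1..?m}" "x < y"
    show "\<pi> x < \<pi> y"
    proof (cases "y + 1 < j")
      case True
      then show ?thesis using mono1[of x y] xy by auto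
    next
      case False
      \<comment> \<open>Now \<open>\<pi> y\<close> ends the cycle, so no \<open>y + 1\<close>
        follows to complete a \<open>321\<close>. Instead \<open>213\<close> is used at the places
        \<open>j\<close>, \<open>\<pi> y\<close> and \<open>n\<close>, the first two of which have
        the values \<open>2\<close> and \<open>1\<close>.\<close>
      then have y: "y = ?m" "y + 1 = j" using xy m by auto
      have 1: "\<pi> (\<pi> y) = 1" using nn[of y] y m by simp
      have \<pi>y: "1 \<le> \<pi> y" "\<pi> y \<le> n" using maps'[of y] y m j_le by auto
      have "\<pi> y = n"
      proof (rule ccontr)
        assume "\<pi> y \<noteq> n"
        have j2: "\<pi> j = 2" using nn[of 1] first m j_ge by simp
        have "\<pi> y \<noteq> j" using inj'[of 1 y] first y m j_ge j_le by auto
        then have "\<pi> n < \<pi> j"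
          using large[of y] y m \<pi>y \<open>\<pi> y \<noteq> n\<close> 1 j2 j_ge by (intro av213[of j "\<pi> y" n]) auto
        then have "\<pi> n = \<pi> (\<pi> y)" using 1 j2 maps'[of n] n_pos by simp
        then show False using inj'[of n "\<pi> y"] \<pi>y \<open>\<pi> y \<noteq> n\<close> n_pos by simp
      qed
      moreover have "\<pi> x \<noteq> \<pi> y" using inj'[of x y] xy y m j_le by auto
      moreover have "\<pi> x \<le> n" using maps'[of x] xy m j_le by auto
      ultimately show ?thesis by simp
    qed
  qed
  have low: "\<pi> x = x + j - 1" if "1 \<le> x" "x \<le> ?m" for x
    using strict_mono_on_interval_eq[OF mono, of j x] first maps'[of ?m] m that by simp
  have mid: "\<pi> x = (if x + 1 < j then x + 1 else 1)" if "?m < x" "x < j" for x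
    using next_small[of x] image_less_iff[of x] that m j_le by simp
  have high: "\<pi> x = (if x + 2 - j < j then x + 2 - j else 1)" if "j \<le> x" "x \<le> n" for x
  proof -
    have "\<pi> (x + 1 - j) = x" using low[of "x + 1 - j"] that m by simp
    then show ?thesis using nn[of "x + 1 - j"] that m by (simp add: Suc_diff_le)
  qed
  \<comment> \<open>At \<open>2 * j = n + 2\<close> the map is the boundary case of
    \<open>medium_first\<close>, except that \<open>j = 3\<close> is filed under
    \<open>three_first\<close>.\<close>
  consider "n + 3 \<le> 2 * j" | "4 \<le> j" "2 * j = n + 2" | "j = 3" "n = 4"
    using A j_ge by linarith
  then show ?thesis
  proof cases
    case 1
    have "\<pi> x = large_first n j x" for x
    proof -
      consider "x = 0 \<or> n < x" | "1 \<le> x" "x \<le> ?m" | "?m < x" "x < j" | "j \<le> x" "x \<le> n"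
        using m by linarith
      then show ?thesis
      proof cases
        case 1
        then show ?thesis using outside[of x] by (auto simp: large_first_def)
      next
        case 2
        then show ?thesis using low[OF 2] m by (auto simp: large_first_def)
      next
        case 3
        then show ?thesis using mid[OF 3] j_le m by (auto simp: large_first_def)
      next
        case 4
        then show ?thesis using high[OF 4] \<open>n + 3 \<le> 2 * j\<close> m j_ge by (auto simp: large_first_def)
      qed
    qed
    then show ?thesis using 1 by blast
  next
    case 2
    have "\<pi> x = medium_first n j x" for x
    proof -
      consider "x = 0 \<or> n < x" | "1 \<le> x" "x \<le> ?m" | "j \<le> x" "x \<le> n"
        using m 2 by linarith
      then show ?thesis
      proof cases
        case 1
        then show ?thesis using outside[of x] by (auto simp: medium_first_def)
      next
        case a: 2
        then show ?thesis using low[OF a] a m 2 by (auto simp: medium_first_def)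
      next
        case b: 3
        then show ?thesis using high[OF b] 2 m by (auto simp: medium_first_def)
      qed
    qed
    then show ?thesis using 2 by blast
  next
    case 3
    have "\<pi> x = three_first n 2 x" for x
    proof -
      consider "x = 0 \<or> n < x" | "x = 1" | "x = 2" | "x = 3" | "x = 4"
        using 3 by linarith
      then show ?thesis
        by cases (use outside[of x] low[of 1] low[of 2] high[of 3] high[of 4] 3 in \<open>auto simp: three_first_def\<close>)
    qed
    then show ?thesis using 3 by blast
  qed
qed

end

section \<open>Small first entry: \<open>2 * j \<le> n + 1\<close>\<close>

locale avoider_small_first = avoider_first +
  fixes m :: nat
  assumes small_first: "2 * j \<le> n + 1"
    and m: "m + j = n + 1"
begin

lemma m_props: "m + j = n + 1" "j \<le> m" "m + 2 \<le> n"
  using small_first j_ge j_le m by auto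

lemma image_less_iff': "1 \<le> x \<Longrightarrow> x \<le> n \<Longrightarrow> \<pi> x < j \<longleftrightarrow> m < x"
  using image_less_iff[of x] m by auto

lemma image_gt: "2 \<le> x \<Longrightarrow> x \<le> m \<Longrightarrow> j < \<pi> x"
  using image_less_iff'[of x] inj'[of 1 x] first n_pos m_props
  by (cases "\<pi> x = j") auto

text \<open>The preimages of \<open>2, \<dots>, j - 1\<close> exceed \<open>j - 1\<close> and precede it in the cycle notation,
  so they occur there in increasing order.\<close>

lemma end_mono:
  assumes uv: "m < u" "u < v" "v \<le> n" and neq: "\<pi> u \<noteq> 1" "\<pi> v \<noteq> 1"
  shows "\<pi> u < \<pi> v"
proof (rule ccontr)
  assume "\<not> \<pi> u < \<pi> v"
  moreover have "\<pi> u \<noteq> \<pi> v" using inj'[of u v] uv by auto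
  ultimately have gt: "\<pi> v < \<pi> u" by simp
  have pu: "p (\<pi> u) = Suc (p u)" and pv: "p (\<pi> v) = Suc (p v)"
    using uv neq by (auto intro!: pos_image')
  have u: "\<pi> u < j" using image_less_iff'[of u] uv by auto
  have v: "1 \<le> \<pi> v" using maps'[of v] uv by auto
  have "p (\<pi> v) < p (\<pi> u)" using gt u v by (intro pos_mono) auto
  then have "p (j - 1) < p u"
    using pu pv uv m_props j_ge by (intro av321[of "j - 1" u v]) auto
  moreover have "p (\<pi> u) \<le> p (j - 1)" using u gt by (intro pos_mono_le) auto
  ultimately show False using pu by simp
qed

text \<open>Strictly inside the block \<open>{m + 1..n}\<close> the entry \<open>1\<close> would
  separate two entries that increase by \<open>end_mono\<close>, and form a \<open>213\<close> with
  them.\<close>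

lemma pre_1: "\<pi> (m + 1) = 1 \<or> \<pi> n = 1"
proof -
  obtain w where w: "1 \<le> w" "w \<le> n" "\<pi> w = 1" using pre[of 1] n_pos by auto
  have "m < w" using image_less_iff'[of w] w j_ge by auto
  show ?thesis
  proof (rule ccontr)
    assume neg: "\<not> ?thesis"
    then have w': "m + 1 < w" "w < n" using w \<open>m < w\<close> by (auto simp: order_less_le)
    then have neq: "\<pi> (m + 1) \<noteq> 1" "\<pi> n \<noteq> 1" using neg by auto
    have "1 \<le> \<pi> (m + 1)" using maps'[of "m + 1"] w' by auto
    then have "\<pi> n < \<pi> (m + 1)"
      using w w' neq by (intro av213[of "m + 1" w n]) auto
    moreover have "\<pi> (m + 1) < \<pi> n" using w' neq by (intro end_mono) auto
    ultimately show False by simp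
  qed
qed

text \<open>The predecessor \<open>u\<close> of \<open>x\<close> exceeds \<open>m\<close>, and the
  cycle reads \<open>u, x, \<pi> x\<close>, with \<open>j - 1\<close> somewhere later because
  \<open>x < j - 1\<close>. If \<open>\<pi> x \<le> m\<close>, then \<open>u, \<pi> x, j - 1\<close>
  is a \<open>321\<close>.\<close>

lemma image_begin_gt:
  assumes x: "2 \<le> x" "x + 1 < j"
  shows "m < \<pi> x"
proof (rule ccontr)
  assume "\<not> m < \<pi> x"
  have gt: "j < \<pi> x" using image_gt[of x] x m_props by auto
  have px: "p (\<pi> x) = Suc (p x)" using x gt j_ge j_le by (intro pos_image') auto
  obtain u where u: "1 \<le> u" "u \<le> n" "\<pi> u = x" using pre[of x] x j_le by auto
  have "m < u" using image_less_iff'[of u] u x by auto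
  have pu: "p x = Suc (p u)" using pos_image'[of u] u x by auto
  have "p (j - 1) < p (\<pi> x)"
    using \<open>\<not> m < \<pi> x\<close> \<open>m < u\<close> u gt px pu j_ge by (intro av321[of "j - 1" "\<pi> x" u]) auto
  moreover have "p x < p (j - 1)" using x by (intro pos_mono) auto
  ultimately show False using px by simp
qed

lemma image_image_begin:
  assumes x: "2 \<le> x" "x + 1 < j"
  shows "\<pi> (\<pi> x) = x + 1"
proof -
  have gt: "m < \<pi> x" using image_begin_gt[OF x] .
  moreover have "\<pi> x \<le> n" using maps'[of x] x j_le by auto
  ultimately have "\<pi> (\<pi> x) < j" using image_less_iff'[of "\<pi> x"] by auto
  then show ?thesis using next_next_small[of x] x gt m_props by auto
qed

text \<open>Suppose \<open>j < \<pi> x < x\<close>. If \<open>x\<close> precedes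
  \<open>j - 1\<close> in the cycle, then \<open>x, \<pi> x, j - 1\<close> is a \<open>321\<close>.
  Otherwise the preimage \<open>u > m\<close> of \<open>2\<close> precedes \<open>x\<close>, and
  \<open>u, x, \<pi> x\<close> is one.\<close>

lemma middle_excedance:
  assumes x: "j \<le> x + 1" "x \<le> m"
  shows "x < \<pi> x"
proof (rule ccontr)
  assume neg: "\<not> x < \<pi> x"
  have gt: "j < \<pi> x" using image_gt[of x] x j_ge by auto
  have px: "p (\<pi> x) = Suc (p x)" using x gt j_ge m_props by (intro pos_image') auto
  have xn: "1 \<le> x" "x \<le> n" using x j_ge m_props by auto
  have "\<pi> x \<noteq> x" using px by (metis n_not_Suc_n)
  then have lt: "\<pi> x < x" using neg by simp
  then have xj: "j - 1 < x" using gt by simp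
  have "p x \<noteq> p (j - 1)"
  proof
    assume eq: "p x = p (j - 1)"
    have "x = j - 1" by (rule pos_inj) (use eq xj xn j_ge in linarith)+
    then show False using xj by simp
  qed
  then consider "p x < p (j - 1)" | "p (j - 1) < p x" by linarith
  then show False
  proof cases
    case 1
    have "p (j - 1) < p (\<pi> x)"
      using lt gt xn px j_ge by (intro av321[of "j - 1" "\<pi> x" x]) auto
    then show False using 1 px by simp
  next
    case 2
    obtain u where u: "1 \<le> u" "u \<le> n" "\<pi> u = 2" using pre[of 2] j_ge j_le by auto
    have "m < u" using image_less_iff'[of u] u j_ge by auto
    have "p 2 = Suc (p u)" using pos_image'[of u] u by auto
    moreover have "p 2 \<le> p (j - 1)" using j_ge by (intro pos_mono_le) auto
    ultimately have "p u < p x" using 2 by simp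
    then have "p (\<pi> x) < p x"
      using \<open>m < u\<close> u lt gt x by (intro av321[of "\<pi> x" x u]) auto
    then show False using px by simp
  qed
qed

text \<open>\<open>N\<close> is the one value above \<open>m + 1\<close> that is left for the middle
  segment: \<open>n\<close> if \<open>\<pi> n = 1\<close>, and \<open>m + 2\<close> if
  \<open>\<pi> (m + 1) = 1\<close>.\<close>

lemma middle:
  assumes N: "m + 2 \<le> N" "N \<le> n"
    and upp: "\<And>x. j \<le> x + 1 \<Longrightarrow> x \<le> m \<Longrightarrow> \<pi> x \<le> N"
    and beg: "\<And>x. 2 \<le> x \<Longrightarrow> x + 1 < j \<Longrightarrow> m + 1 < \<pi> x \<and> \<pi> x \<noteq> N"
  shows "\<exists>t. j \<le> t + 1 \<and> t \<le> m \<and> \<pi> t = N \<and> (\<forall>x. j \<le> x + 1 \<longrightarrow> x < t \<longrightarrow> \<pi> x = x + 2) \<and>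
    (\<forall>x. t < x \<longrightarrow> x \<le> m \<longrightarrow> \<pi> x = x + 1)"
proof -
  have "\<exists>t. j - 1 \<le> t \<and> t \<le> m \<and> \<pi> t = N \<and> (\<forall>x. j - 1 \<le> x \<longrightarrow> x < t \<longrightarrow> \<pi> x = x + 2) \<and>
    (\<forall>x. t < x \<longrightarrow> x \<le> m \<longrightarrow> \<pi> x = x + 1)"
  proof (rule excedances_avoiding_213)
    show "x < \<pi> x" if "j - 1 \<le> x" "x \<le> m" for x using middle_excedance[of x] that by simp
    show "j - 1 + 2 \<le> \<pi> x" if "j - 1 \<le> x" "x \<le> m" for x
    proof -
      have "2 \<le> x" using that j_ge by linarith
      then show ?thesis using image_gt[of x] that j_ge by simp
    qed
    show "\<pi> x \<le> N" if "j - 1 \<le> x" "x \<le> m" for x using upp[of x] that by simp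
    show "m + 2 \<le> N" by (rule N)
    show "\<exists>x. j - 1 \<le> x \<and> x \<le> m \<and> \<pi> x = v" if v: "j - 1 + 2 \<le> v" "v \<le> m + 1 \<or> v = N" for v
    proof -
      have "v \<le> n" using v N m_props by auto
      then obtain x where x: "1 \<le> x" "x \<le> n" "\<pi> x = v" using pre[of v] v by auto
      have "x \<le> m" using image_less_iff'[of x] x v by auto
      moreover have "x \<noteq> 1" using x first v by auto
      moreover have "\<not> (2 \<le> x \<and> x + 1 < j)" using beg[of x] x v by auto
      ultimately show ?thesis using x by (intro exI[of _ x]) auto
    qed
    show "inj_on \<pi> {j - 1..m}"
      using j_ge m_props by (intro inj_on_subset[OF inj]) auto
    show "\<pi> w < \<pi> u" if "j - 1 \<le> u" "u < v" "v < w" "w \<le> m" "\<pi> v < \<pi> u" for u v w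
      using that j_ge m_props by (intro av213[of u v w]) auto
    show "j - 1 \<le> m" using m_props by simp
  qed
  then show ?thesis by (simp add: le_diff_conv)
qed

text \<open>On \<open>{m + 1..n - 1}\<close> the map increases with \<open>j - 2\<close> values in
  \<open>{2..j - 1}\<close>, so it is a translation. Then \<open>\<pi> (\<pi> x) = x + 1\<close>
  determines it on \<open>{2..j - 2}\<close>, and above \<open>m + 1\<close> only the value
  \<open>n\<close> remains for the middle.\<close>

lemma classify_last_1:
  assumes last: "\<pi> n = 1"
  shows "4 \<le> j \<and> \<pi> = medium_first n j \<or>
    (\<exists>s. 1 \<le> s \<and> 2 * s + 2 \<le> n \<and> \<pi> = three_first n (2 * s))"
proof -
  have only: "\<pi> x \<noteq> 1" if "1 \<le> x" "x < n" for x
    using inj'[of x n] last that by auto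
  have "\<pi> (n - 1) < j"
    by (subst image_less_iff') (use m_props j_ge in linarith)+
  have "strict_mono_on {m + 1..n - 1} \<pi>"
    using only by (intro strict_mono_onI end_mono) auto
  moreover have "2 \<le> \<pi> (m + 1)"
    using maps'[of "m + 1"] only[of "m + 1"] m_props by simp
  moreover have "\<pi> (n - 1) \<le> 2 + (n - 1 - (m + 1))"
    using \<open>\<pi> (n - 1) < j\<close> m_props j_ge by linarith
  ultimately have tail: "\<pi> x = x + 1 - m" if "m < x" "x < n" for x
    using strict_mono_on_interval_eq[of "m + 1" "n - 1" \<pi> 2 x] that by simp
  have beg: "\<pi> x = x + m" if x: "2 \<le> x" "x + 1 < j" for x
  proof -
    have gt: "m < \<pi> x" using image_begin_gt[OF x] .
    have ii: "\<pi> (\<pi> x) = x + 1" using image_image_begin[OF x] .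
    then have "\<pi> x \<noteq> n" using last x by auto
    then have "\<pi> x < n" using maps'[of x] x j_le by simp
    then show ?thesis using tail[of "\<pi> x"] gt ii by simp
  qed
  have "\<exists>t. j \<le> t + 1 \<and> t \<le> m \<and> \<pi> t = n \<and> (\<forall>x. j \<le> x + 1 \<longrightarrow> x < t \<longrightarrow> \<pi> x = x + 2) \<and>
    (\<forall>x. t < x \<longrightarrow> x \<le> m \<longrightarrow> \<pi> x = x + 1)"
  proof (rule middle)
    show "m + 1 < \<pi> x \<and> \<pi> x \<noteq> n" if "2 \<le> x" "x + 1 < j" for x
      using beg[OF that] that m_props by simp
    show "\<pi> x \<le> n" if "j \<le> x + 1" "x \<le> m" for x
      using maps'[of x] that m_props j_ge by simp
  qed (use m_props in auto)
  then obtain t where t: "j \<le> t + 1" "t \<le> m" "\<pi> t = n"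
    and lt: "\<And>x. j \<le> x + 1 \<Longrightarrow> x < t \<Longrightarrow> \<pi> x = x + 2"
    and gt: "\<And>x. t < x \<Longrightarrow> x \<le> m \<Longrightarrow> \<pi> x = x + 1" by blast
  show ?thesis
  proof (cases "j = 3")
    case False
    \<comment> \<open>For \<open>j > 3\<close> the place \<open>2\<close> carries
      \<open>m + 2\<close>; a later smaller entry at \<open>j - 1\<close> followed by
      \<open>n\<close> at \<open>t\<close> would be a \<open>213\<close>. For \<open>j = 3\<close>
      there is no such place and \<open>t\<close> keeps its freedom.\<close>
    have "t = j - 1"
    proof (rule ccontr)
      assume "t \<noteq> j - 1"
      then have "j - 1 < t" using t by simp
      then have "\<pi> (j - 1) = j + 1" using lt[of "j - 1"] j_ge by simp
      moreover have "\<pi> 2 = m + 2" using beg[of 2] False j_ge by simp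
      ultimately have "\<pi> t < \<pi> 2"
        using \<open>j - 1 < t\<close> t False j_ge m_props by (intro av213[of 2 "j - 1" t]) auto
      then show False using t \<open>\<pi> 2 = m + 2\<close> m_props by simp
    qed
    have "\<pi> x = medium_first n j x" for x
    proof -
      consider "x = 0 \<or> n < x" | "x = 1" | "2 \<le> x" "x + 1 < j" | "x = j - 1" | "j \<le> x" "x \<le> m"
        | "m < x" "x < n" | "x = n" using m_props by linarith
      then show ?thesis
      proof cases
        case 1
        then show ?thesis using outside[of x] by (auto simp: medium_first_def)
      next
        case 2
        then show ?thesis using first n_pos by (auto simp: medium_first_def)
      next
        case 3
        then show ?thesis using beg[OF 3] j_le m_props by (auto simp: medium_first_def)
      next
        case 4
        then show ?thesis using t \<open>t = j - 1\<close> j_ge m_props by (auto simp: medium_first_def)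
      next
        case 5
        then show ?thesis using gt[of x] \<open>t = j - 1\<close> j_ge m_props by (auto simp: medium_first_def)
      next
        case 6
        then show ?thesis using tail[OF 6] j_ge m_props by (auto simp: medium_first_def)
      next
        case 7
        then show ?thesis using last j_ge m_props by (auto simp: medium_first_def)
      qed
    qed
    then show ?thesis using False j_ge by auto
  next
    case True
    then have m: "m = n - 2" using m_props by simp
    \<comment> \<open>From \<open>1\<close> the orbit runs through \<open>3, 5, ...\<close>;
      reaching \<open>t\<close> on the way, it would jump to \<open>n\<close> and close without
      visiting \<open>2\<close>.\<close>
    have "even t"
    proof (rule ccontr)
      assume "odd t"
      then obtain k where k: "t = 2 * k + 1" by (elim oddE)
      then obtain i where i: "t = 3 + 2 * i" using t True by (intro that[of "k - 1"]) auto
      have pos: "3 + 2 * l \<le> t \<Longrightarrow> p (3 + 2 * l) = 1 + l" for l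
      proof (induction l)
        case 0
        then show ?case using pos_j True by simp
      next
        case (Suc l)
        then have "\<pi> (3 + 2 * l) = 3 + 2 * Suc l" using lt[of "3 + 2 * l"] True by simp
        then show ?case using Suc pos_image'[of "3 + 2 * l"] t m_props by simp
      qed
      have "p t = 1 + i" using pos[of i] i by simp
      then have "p n = 2 + i" using pos_image'[of t] t i m_props by simp
      moreover have "Suc (p n) = n" using pos_of_preimage_1[of n] last n_pos by simp
      ultimately show False using i t m_props True by simp
    qed
    then obtain s where s: "t = 2 * s" by (elim evenE)
    have "\<pi> x = three_first n (2 * s) x" for x
    proof -
      consider "x = 0 \<or> n < x" | "x = 1" | "2 \<le> x" "x < t" | "x = t" | "t < x" "x \<le> m"
        | "x = n - 1" | "x = n" using m by linarith
      then show ?thesis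
      proof cases
        case 1
        then show ?thesis using outside[of x] by (auto simp: three_first_def)
      next
        case 2
        then show ?thesis using first True n_pos by (auto simp: three_first_def)
      next
        case 3
        then show ?thesis using lt[of x] t s m_props True by (auto simp: three_first_def)
      next
        case 4
        then show ?thesis using t s m_props True by (auto simp: three_first_def)
      next
        case 5
        then show ?thesis using gt[of x] t s m_props True by (auto simp: three_first_def)
      next
        case 6
        then show ?thesis using tail[of "n - 1"] t s m_props True by (auto simp: three_first_def)
      next
        case 7
        then show ?thesis using last t s m_props True by (auto simp: three_first_def)
      qed
    qed
    then have "\<pi> = three_first n (2 * s)" by auto
    moreover have "1 \<le> s" "2 * s + 2 \<le> n" using s t True m_props by auto
    ultimately show ?thesis by blast
  qed
qed

text \<open>Now the final block is \<open>1, ..., j - 1\<close> and the places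
  \<open>2, ..., j - 2\<close> carry \<open>m + 3, ..., n\<close>, which leaves \<open>m + 2\<close>
  for the middle.\<close>

lemma classify_end_1:
  assumes last: "\<pi> (m + 1) = 1"
  shows "\<exists>d. 2 * j + 2 * d \<le> n + 1 \<and> \<pi> = small_last n j (j + 2 * d)"
proof -
  have only: "\<pi> x \<noteq> 1" if "1 \<le> x" "x \<le> n" "x \<noteq> m + 1" for x
    using inj'[of x "m + 1"] last that m_props by auto
  have "\<pi> n < j"
    by (subst image_less_iff') (use m_props j_ge in linarith)+
  have "strict_mono_on {m + 1..n} \<pi>"
  proof (rule strict_mono_onI)
    fix x y assume xy: "x \<in> {m + 1..n}" "y \<in> {m + 1..n}" "x < y"
    show "\<pi> x < \<pi> y"
    proof (cases "x = m + 1")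
      case True
      then show ?thesis using last only[of y] maps'[of y] xy by simp
    next
      case False
      then show ?thesis using only xy by (intro end_mono) auto
    qed
  qed
  moreover have "\<pi> n \<le> 1 + (n - (m + 1))"
    using \<open>\<pi> n < j\<close> m_props j_ge by linarith
  ultimately have tail: "\<pi> x = x - m" if "m < x" "x \<le> n" for x
    using strict_mono_on_interval_eq[of "m + 1" n \<pi> 1 x] last that by simp
  have beg: "\<pi> x = x + m + 1" if x: "2 \<le> x" "x + 1 < j" for x
    using image_begin_gt[OF x] image_image_begin[OF x] maps'[of x] x tail[of "\<pi> x"] j_le by simp
  have "\<exists>t. j \<le> t + 1 \<and> t \<le> m \<and> \<pi> t = m + 2 \<and> (\<forall>x. j \<le> x + 1 \<longrightarrow> x < t \<longrightarrow> \<pi> x = x + 2) \<and>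
    (\<forall>x. t < x \<longrightarrow> x \<le> m \<longrightarrow> \<pi> x = x + 1)"
  proof (rule middle)
    show "m + 1 < \<pi> x \<and> \<pi> x \<noteq> m + 2" if "2 \<le> x" "x + 1 < j" for x
      using beg[OF that] that by simp
    show "\<pi> x \<le> m + 2" if x: "j \<le> x + 1" "x \<le> m" for x
    proof (rule ccontr)
      assume gt: "\<not> \<pi> x \<le> m + 2"
      have "\<pi> x \<le> n" using maps'[of x] x m_props j_ge by simp
      \<comment> \<open>A value above \<open>m + 2\<close> is already taken in
        \<open>{2..j - 2}\<close>, namely at \<open>\<pi> x - m - 1\<close>.\<close>
      then have eq: "\<pi> (\<pi> x - m - 1) = \<pi> x" using beg[of "\<pi> x - m - 1"] gt m_props by simp
      have "\<pi> x - m - 1 = x"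
        by (rule inj') (use eq \<open>\<pi> x \<le> n\<close> x j_ge m_props gt in auto)
      then show False using x \<open>\<pi> x \<le> n\<close> m_props gt by simp
    qed
  qed (use m_props in auto)
  then obtain t where t: "j \<le> t + 1" "t \<le> m" "\<pi> t = m + 2"
    and lt: "\<And>x. j \<le> x + 1 \<Longrightarrow> x < t \<Longrightarrow> \<pi> x = x + 2"
    and gt: "\<And>x. t < x \<Longrightarrow> x \<le> m \<Longrightarrow> \<pi> x = x + 1" by blast
  \<comment> \<open>Otherwise steps of 2 lead from \<open>j - 1\<close> to \<open>t\<close>, then on
    to \<open>m + 2\<close> and \<open>2\<close>, so that \<open>2\<close> would come after
    \<open>j - 1\<close> in the cycle.\<close>
  have "\<not> even (t + 1 - j)"
  proof
    assume "even (t + 1 - j)"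
    then obtain i where "t + 1 - j = 2 * i" by (elim evenE)
    then have i: "t = j - 1 + 2 * i" using t j_ge by simp
    have pos: "j - 1 + 2 * l \<le> t \<Longrightarrow> p (j - 1) \<le> p (j - 1 + 2 * l)" for l
    proof (induction l)
      case (Suc l)
      then have "\<pi> (j - 1 + 2 * l) = j - 1 + 2 * Suc l"
        using lt[of "j - 1 + 2 * l"] by simp
      moreover have "p (\<pi> (j - 1 + 2 * l)) = Suc (p (j - 1 + 2 * l))"
        using Suc.prems t m_props j_ge calculation by (intro pos_image') auto
      ultimately show ?case using Suc by simp
    qed simp
    have "p (j - 1) \<le> p t" using pos[of i] i by simp
    moreover have "p (m + 2) = Suc (p t)" using pos_image'[of t] t j_ge m_props by simp
    moreover have "p 2 = Suc (p (m + 2))"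
      using pos_image'[of "m + 2"] tail[of "m + 2"] m_props by simp
    moreover have "p 2 \<le> p (j - 1)" using j_ge by (intro pos_mono_le) auto
    ultimately show False by simp
  qed
  then obtain d where "t + 1 - j = 2 * d + 1" by (elim oddE)
  then have d: "t = j + 2 * d" using t by simp
  have "\<pi> x = small_last n j (j + 2 * d) x" for x
  proof -
    consider "x = 0 \<or> n < x" | "x = 1" | "2 \<le> x" "x + 1 < j" | "j \<le> x + 1" "x < t" | "x = t"
      | "t < x" "x \<le> m" | "m < x" "x \<le> n" using j_ge by linarith
    then show ?thesis
    proof cases
      case 1
      then show ?thesis using outside[of x] by (auto simp: small_last_def)
    next
      case 2
      then show ?thesis using first n_pos by (auto simp: small_last_def)
    next
      case 3
      then show ?thesis using beg[OF 3] j_le m_props by (auto simp: small_last_def)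
    next
      case 4
      then show ?thesis using lt[OF 4] t d j_ge m_props by (auto simp: small_last_def)
    next
      case 5
      then show ?thesis using t d j_ge m_props by (auto simp: small_last_def)
    next
      case 6
      then show ?thesis using gt[of x] t d j_ge m_props by (auto simp: small_last_def)
    next
      case 7
      then show ?thesis using tail[OF 7] t d j_ge m_props by (auto simp: small_last_def)
    qed
  qed
  moreover have "2 * j + 2 * d \<le> n + 1" using d t m_props by simp
  ultimately show ?thesis by blast
qed

end

lemma (in avoider_first) classification:
  "n + 3 \<le> 2 * j \<and> \<pi> = large_first n j \<or>
   4 \<le> j \<and> 2 * j \<le> n + 2 \<and> \<pi> = medium_first n j \<or>
   (\<exists>d. 2 * j + 2 * d \<le> n + 1 \<and> \<pi> = small_last n j (j + 2 * d)) \<or>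
   (\<exists>s. 1 \<le> s \<and> 2 * s + 2 \<le> n \<and> \<pi> = three_first n (2 * s))"
proof (cases "n + 2 \<le> 2 * j")
  case True
  then consider "n + 3 \<le> 2 * j \<and> \<pi> = large_first n j"
    | "4 \<le> j" "2 * j = n + 2" "\<pi> = medium_first n j"
    | "n = 4" "\<pi> = three_first n 2"
    using classify_large by blast
  then show ?thesis
  proof cases
    case 3
    then have "1 \<le> (1 :: nat) \<and> 2 * 1 + 2 \<le> n \<and> \<pi> = three_first n (2 * 1)" by simp
    then show ?thesis by blast
  qed auto
next
  case False
  then interpret avoider_small_first n \<pi> p j "n + 1 - j"
    by unfold_locales (use j_le in auto)
  show ?thesis using pre_1 classify_last_1 classify_end_1 small_first by auto
qed

subsection \<open>Counting\<close>

definition avoiders :: "nat \<Rightarrow> (nat \<Rightarrow> nat) set" where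
  "avoiders n = {\<pi>. \<exists>p. avoider n \<pi> p}"

definition avoiders_last_1 :: "nat \<Rightarrow> (nat \<Rightarrow> nat) set" where
  "avoiders_last_1 n = {\<pi> \<in> avoiders n. \<pi> n = 1}"

definition avoiders_first_2 :: "nat \<Rightarrow> (nat \<Rightarrow> nat) set" where
  "avoiders_first_2 n = {\<pi> \<in> avoiders n. \<pi> 1 = 2}"

definition avoiders_first_ge_3 :: "nat \<Rightarrow> (nat \<Rightarrow> nat) set" where
  "avoiders_first_ge_3 n = {\<pi> \<in> avoiders n. 3 \<le> \<pi> 1}"

section \<open>First entry \<open>2\<close> and the deletion of \<open>1\<close>\<close>

lemma (in avoider) first_ge_2: "2 \<le> n \<Longrightarrow> 2 \<le> \<pi> 1"
  using pos_of_preimage_1[of 1] pos_1 maps[of 1] by (cases "\<pi> 1 = 1") auto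

text \<open>By \<open>213\<close> with the first entry \<open>2\<close>, only entries below
  \<open>2\<close> may follow the entry \<open>1\<close>, hence none.\<close>

lemma (in avoider) last_eq_1:
  assumes n: "2 \<le> n" and first: "\<pi> 1 = 2"
  shows "\<pi> n = 1"
proof -
  obtain w where w: "w \<in> {1..n}" "\<pi> w = 1" using preimage[of 1] n by auto
  have "w \<noteq> 1" using w first by auto
  have "w = n"
  proof (rule ccontr)
    assume "w \<noteq> n"
    then have "\<pi> n < \<pi> 1" using w \<open>w \<noteq> 1\<close> first by (intro av213[of 1 w n]) auto
    then have "\<pi> n = \<pi> w" using first w maps[of n] n by auto
    then show False using inj_iff[of n w] w n \<open>w \<noteq> n\<close> by auto
  qed
  then show ?thesis using w by simp
qed

lemma avoiders_eq_Un:
  "2 \<le> n \<Longrightarrow> avoiders n = avoiders_first_2 n \<union> avoiders_first_ge_3 n"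
  using avoider.first_ge_2 by (force simp: avoiders_def avoiders_first_2_def avoiders_first_ge_3_def)

lemma avoiders_last_1_eq_Un:
  "2 \<le> n \<Longrightarrow> avoiders_last_1 n =
     avoiders_first_2 n \<union> (avoiders_last_1 n \<inter> avoiders_first_ge_3 n)"
  using avoider.first_ge_2 avoider.last_eq_1
  by (force simp: avoiders_def avoiders_first_2_def avoiders_first_ge_3_def avoiders_last_1_def)

text \<open>On one-line notations ending in \<open>1\<close>, prepending a \<open>1\<close> to the cycle notation (and
  shifting it up) prepends a \<open>2\<close> to the one-line notation.\<close>

definition shift :: "nat \<Rightarrow> (nat \<Rightarrow> nat) \<Rightarrow> nat \<Rightarrow> nat" where
  "shift k \<sigma> x = (if x = 1 then 2 else if 1 < x \<and> x \<le> k then \<sigma> (x - 1) + 1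
     else if x = k + 1 then 1 else x)"

text \<open>Without \<open>1\<close> the cycle leads from \<open>k + 1\<close> back to
  \<open>2\<close>; after relabelling, \<open>k\<close> is mapped to \<open>1\<close>.\<close>

definition unshift :: "nat \<Rightarrow> (nat \<Rightarrow> nat) \<Rightarrow> nat \<Rightarrow> nat" where
  "unshift k \<pi> x = (if 1 \<le> x \<and> x < k then \<pi> (x + 1) - 1 else if x = k then 1 else x)"

text \<open>As \<open>k\<close> ends the cycle of \<open>\<sigma>\<close>, a new least element in
  front only redirects the closing step. The new first entry \<open>2\<close> starts no
  \<open>213\<close>, because the only smaller entry is the last one, and a leading \<open>1\<close>
  in the cycle is part of no \<open>321\<close>.\<close>

lemma avoider_shift:
  assumes "avoider k \<sigma> p" and last: "\<sigma> k = 1"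
  shows "avoider (k + 1) (shift k \<sigma>) (\<lambda>x. if x = 1 then 0 else p (x - 1) + 1)"
    (is "avoider _ _ ?p")
proof -
  interpret avoider k \<sigma> p by fact
  have pk: "Suc (p k) = k" using pos_of_preimage_1[of k] last n_pos by simp
  show ?thesis
  proof
    fix x assume x: "x \<in> {1..k + 1}"
    have maps': "1 \<le> \<sigma> y \<and> \<sigma> y \<le> k" if "1 \<le> y" "y \<le> k" for y using maps[of y] that by auto
    have x': "x - 1 \<in> {1..k}" if "x \<noteq> 1" using x that by auto
    show "shift k \<sigma> x \<in> {1..k + 1}"
      using x n_pos maps'[of "x - 1"] by (auto simp: shift_def)
    show "?p x < k + 1"
      using pos_less[OF x'] by simp
    show "?p (shift k \<sigma> x) = Suc (?p x)" if less: "Suc (?p x) < k + 1"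
    proof -
      consider "x = 1" | "1 < x" "x \<le> k" | "x = k + 1" "1 < x" using x n_pos by force
      then show ?thesis
      proof cases
        case 1
        then show ?thesis using pos_1 by (simp add: shift_def)
      next
        case 2
        then have "1 \<le> x - 1" "x - 1 \<le> k" by auto
        then show ?thesis using 2 less pos_step[OF x'] maps'[of "x - 1"] by (simp add: shift_def)
      next
        case 3
        then show ?thesis using less pk by simp
      qed
    qed
    show "shift k \<sigma> x = 1" if last': "Suc (?p x) = k + 1"
    proof -
      have "x \<noteq> 1" using last' n_pos by (auto split: if_splits)
      then have "\<sigma> (x - 1) = 1" using x last' by (intro pos_last) auto
      then have "x - 1 = k"
        using inj_iff[OF x', of k] last \<open>x \<noteq> 1\<close> n_pos by simp
      then have "x = k + 1" using n_pos by linarith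
      then show ?thesis using n_pos by (simp add: shift_def)
    qed
  next
    fix a b c
    assume abc: "1 \<le> a" "a < b" "b < c" "c \<le> k + 1" "shift k \<sigma> b < shift k \<sigma> a"
    have maps': "1 \<le> \<sigma> y" if "1 \<le> y" "y \<le> k" for y using maps[of y] that by auto
    have b: "shift k \<sigma> b = \<sigma> (b - 1) + 1" using abc by (simp add: shift_def)
    have "1 \<le> b - 1" "b - 1 \<le> k" using abc by auto
    then have "a \<noteq> 1" using b abc(5) maps'[of "b - 1"] by (auto simp: shift_def)
    then have a1: "1 \<le> a - 1" "a - 1 \<le> k" using abc by auto
    have a: "shift k \<sigma> a = \<sigma> (a - 1) + 1" using abc \<open>a \<noteq> 1\<close> by (simp add: shift_def)
    show "shift k \<sigma> c < shift k \<sigma> a"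
    proof (cases "c = k + 1")
      case True
      then show ?thesis using a maps'[OF a1] abc by (simp add: shift_def)
    next
      case False
      then have "\<sigma> (c - 1) < \<sigma> (a - 1)"
        using abc a b \<open>a \<noteq> 1\<close> by (intro av213[of "a - 1" "b - 1" "c - 1"]) auto
      then show ?thesis using a False abc by (simp add: shift_def)
    qed
  next
    fix x y z
    assume "1 \<le> z" "z < y" "y < x" "x \<le> k + 1" "?p x < ?p y"
    then show "?p z < ?p y"
      using av321[of "z - 1" "y - 1" "x - 1"] by auto
  qed (use n_pos in \<open>auto simp: shift_def\<close>)
qed

lemma avoider_unshift:
  assumes "avoider (k + 1) \<pi> p" and first: "\<pi> 1 = 2" and k: "1 \<le> k"
  shows "avoider k (unshift k \<pi>) (\<lambda>x. p (x + 1) - 1)" (is "avoider _ _ ?p")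
proof -
  interpret avoider "k + 1" \<pi> p by fact
  have last: "\<pi> (k + 1) = 1" using last_eq_1 first k by simp
  have pk: "p (k + 1) = k" using pos_of_preimage_1[of "k + 1"] last by simp
  have p2: "p 2 = 1" using pos_step[of 1] pos_1 first k by simp
  have pos: "1 \<le> p (x + 1)" if "1 \<le> x" "x \<le> k" for x
    using pos_gt_0[of "x + 1"] that by simp
  have mid: "3 \<le> \<pi> (x + 1) \<and> \<pi> (x + 1) \<le> k + 1" if "1 \<le> x" "x < k" for x
    using maps[of "x + 1"] inj_iff[of "x + 1" 1] inj_iff[of "x + 1" "k + 1"] first last that
    by (cases "\<pi> (x + 1) = 1"; cases "\<pi> (x + 1) = 2") auto
  show ?thesis
  proof
    fix x assume "x \<in> {1..k}"
    then have x: "1 \<le> x" "x \<le> k" by auto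
    show "unshift k \<pi> x \<in> {1..k}"
      using x mid[of x] by (auto simp: unshift_def)
    show "?p x < k"
      using x pos_less[of "x + 1"] pos[of x] by auto
    show "?p (unshift k \<pi> x) = Suc (?p x)" if less: "Suc (?p x) < k"
    proof -
      have "x \<noteq> k" using less pk by auto
      then have xk: "x < k" using x by simp
      then have "p (\<pi> (x + 1)) = Suc (p (x + 1))"
        using mid[of x] x by (intro pos_image) auto
      moreover have "unshift k \<pi> x + 1 = \<pi> (x + 1)"
        using mid[of x] x xk by (simp add: unshift_def)
      ultimately show ?thesis using pos[of x] x by simp
    qed
    show "unshift k \<pi> x = 1" if "Suc (?p x) = k"
    proof -
      have "\<pi> (x + 1) = 1" using that pos[of x] x by (intro pos_last) auto
      then have "\<not> 3 \<le> \<pi> (x + 1)" by simp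
      then have "x = k" using mid x by (meson le_neq_implies_less)
      then show ?thesis using x by (simp add: unshift_def)
    qed
  next
    fix a b c
    assume abc: "1 \<le> a" "a < b" "b < c" "c \<le> k" "unshift k \<pi> b < unshift k \<pi> a"
    then have "\<pi> (b + 1) < \<pi> (a + 1)" using mid[of a] mid[of b] by (simp add: unshift_def)
    then have "\<pi> (c + 1) < \<pi> (a + 1)"
      using abc by (intro av213[of "a + 1" "b + 1" "c + 1"]) auto
    then show "unshift k \<pi> c < unshift k \<pi> a"
      using mid[of a] mid[of c] abc by (auto simp: unshift_def)
  next
    fix x y z
    assume *: "1 \<le> z" "z < y" "y < x" "x \<le> k" "?p x < ?p y"
    then have "p (z + 1) < p (y + 1)"
      by (intro av321[of "z + 1" "y + 1" "x + 1"]) linarith+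
    then show "?p z < ?p y"
      using pos[of z] * by (intro diff_less_mono) auto
  qed (use k p2 in \<open>auto simp: unshift_def numeral_2_eq_2\<close>)
qed

lemma card_avoiders_first_2:
  assumes k: "1 \<le> k"
  shows "card (avoiders_first_2 (k + 1)) = card (avoiders_last_1 k)"
proof -
  have "bij_betw (shift k) (avoiders_last_1 k) (avoiders_first_2 (k + 1))"
  proof (rule bij_betw_byWitness[where f' = "unshift k"])
    show "\<forall>\<sigma>\<in>avoiders_last_1 k. unshift k (shift k \<sigma>) = \<sigma>"
    proof
      fix \<sigma> assume "\<sigma> \<in> avoiders_last_1 k"
      then obtain p where "avoider k \<sigma> p" and last: "\<sigma> k = 1"
        by (auto simp: avoiders_last_1_def avoiders_def)
      interpret avoider k \<sigma> p by fact
      show "unshift k (shift k \<sigma>) = \<sigma>"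
        using last outside by (auto simp: unshift_def shift_def fun_eq_iff)
    qed
    show "\<forall>\<pi>\<in>avoiders_first_2 (k + 1). shift k (unshift k \<pi>) = \<pi>"
    proof
      fix \<pi> assume "\<pi> \<in> avoiders_first_2 (k + 1)"
      then obtain p where av: "avoider (k + 1) \<pi> p" and first: "\<pi> 1 = 2"
        by (auto simp: avoiders_first_2_def avoiders_def)
      interpret avoider "k + 1" \<pi> p by fact
      have "\<pi> (k + 1) = 1" using last_eq_1 first k by simp
      moreover have "Suc (\<pi> x - Suc 0) = \<pi> x" if "1 < x" "x \<le> k" for x
        using maps[of x] that by auto
      ultimately show "shift k (unshift k \<pi>) = \<pi>"
        using first k outside by (auto simp: unshift_def shift_def fun_eq_iff)
    qed
    show "shift k ` avoiders_last_1 k \<subseteq> avoiders_first_2 (k + 1)"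
      using avoider_shift by (fastforce simp: avoiders_last_1_def avoiders_first_2_def avoiders_def shift_def)
    show "unshift k ` avoiders_first_2 (k + 1) \<subseteq> avoiders_last_1 k"
      using avoider_unshift k by (fastforce simp: avoiders_last_1_def avoiders_first_2_def avoiders_def unshift_def)
  qed
  then show ?thesis by (simp add: bij_betw_same_card)
qed

lemma card_avoiders_last_1_1: "card (avoiders_last_1 1) = 1"
proof -
  have av: "avoider 1 id (\<lambda>_. 0)"
    unfolding avoider_def cycle_position_def avoider_axioms_def by simp
  have uniq: "\<pi> = id" if "avoider 1 \<pi> p" "\<pi> 1 = 1" for \<pi> p
  proof
    fix x
    interpret avoider 1 \<pi> p by fact
    show "\<pi> x = id x" using outside[of x] that by (cases "x = 1") auto
  qed
  have "avoiders_last_1 1 = {id}"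
  proof
    show "avoiders_last_1 1 \<subseteq> {id}"
      using uniq unfolding avoiders_last_1_def avoiders_def by blast
    show "{id} \<subseteq> avoiders_last_1 1"
      using av id_apply[of "1 :: nat"] unfolding avoiders_last_1_def avoiders_def by blast
  qed
  then show ?thesis by simp
qed

section \<open>Sizes of the four families\<close>

definition large_firsts :: "nat \<Rightarrow> (nat \<Rightarrow> nat) set" where
  "large_firsts n = large_first n ` {(n + 4) div 2..n}"

text \<open>The range starts at 4 because \<open>medium_first n 3\<close> agrees with
  \<open>three_first n 2\<close> for \<open>n \<ge> 4\<close>.\<close>

definition medium_firsts :: "nat \<Rightarrow> (nat \<Rightarrow> nat) set" where
  "medium_firsts n = medium_first n ` {4..(n + 2) div 2}"

definition small_lasts :: "nat \<Rightarrow> (nat \<Rightarrow> nat) set" where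
  "small_lasts n = (\<lambda>(j, d). small_last n j (j + 2 * d)) ` {(j, d). 3 \<le> j \<and> j + d \<le> (n + 1) div 2}"

definition three_firsts :: "nat \<Rightarrow> (nat \<Rightarrow> nat) set" where
  "three_firsts n = (\<lambda>s. three_first n (2 * s)) ` {1..(n - 2) div 2}"

lemma (in avoider_first) in_families:
  "\<pi> \<in> (large_firsts n \<union> small_lasts n) \<union> (medium_firsts n \<union> three_firsts n)" (is "\<pi> \<in> ?F")
  using classification
proof (elim disjE exE conjE)
  assume "n + 3 \<le> 2 * j" and eq: "\<pi> = large_first n j"
  \<comment> \<open>\<open>(n + 4) div 2\<close> is the least \<open>j\<close> with
    \<open>n + 3 \<le> 2 * j\<close>.\<close>
  then have "j \<in> {(n + 4) div 2..n}" using j_le by auto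
  then have "large_first n j \<in> large_firsts n" unfolding large_firsts_def by (rule imageI)
  then show "\<pi> \<in> ?F" unfolding eq by (intro UnI1)
next
  assume "4 \<le> j" "2 * j \<le> n + 2" and eq: "\<pi> = medium_first n j"
  then have "j \<in> {4..(n + 2) div 2}" by auto
  then have "medium_first n j \<in> medium_firsts n" unfolding medium_firsts_def by (rule imageI)
  then show "\<pi> \<in> ?F" unfolding eq by (intro UnI2 UnI1)
next
  fix d assume "2 * j + 2 * d \<le> n + 1" and eq: "\<pi> = small_last n j (j + 2 * d)"
  then have "(j, d) \<in> {(j, d). 3 \<le> j \<and> j + d \<le> (n + 1) div 2}" using j_ge by auto
  then have "small_last n j (j + 2 * d) \<in> small_lasts n"
    unfolding small_lasts_def by (rule rev_image_eqI) simp
  then show "\<pi> \<in> ?F" unfolding eq by (intro UnI1 UnI2)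
next
  fix s assume "1 \<le> s" "2 * s + 2 \<le> n" and eq: "\<pi> = three_first n (2 * s)"
  then have "s \<in> {1..(n - 2) div 2}" by auto
  then have "three_first n (2 * s) \<in> three_firsts n" unfolding three_firsts_def by (rule imageI)
  then show "\<pi> \<in> ?F" unfolding eq by (intro UnI2)
qed

lemma avoiders_first_ge_3_eq:
  assumes n: "2 \<le> n"
  shows "avoiders_first_ge_3 n =
    (large_firsts n \<union> small_lasts n) \<union> (medium_firsts n \<union> three_firsts n)"
proof (intro equalityI subsetI)
  fix \<pi> assume "\<pi> \<in> avoiders_first_ge_3 n"
  then obtain p where "avoider n \<pi> p" and "3 \<le> \<pi> 1"
    by (auto simp: avoiders_first_ge_3_def avoiders_def)
  then have "avoider_first n \<pi> p (\<pi> 1)"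
    by (simp add: avoider_first_def avoider_first_axioms_def)
  then show "\<pi> \<in> (large_firsts n \<union> small_lasts n) \<union> (medium_firsts n \<union> three_firsts n)"
    by (rule avoider_first.in_families)
next
  fix \<pi> assume "\<pi> \<in> (large_firsts n \<union> small_lasts n) \<union> (medium_firsts n \<union> three_firsts n)"
  then consider j where "(n + 4) div 2 \<le> j" "j \<le> n" "\<pi> = large_first n j"
    | j where "4 \<le> j" "j \<le> (n + 2) div 2" "\<pi> = medium_first n j"
    | j d where "3 \<le> j" "j + d \<le> (n + 1) div 2" "\<pi> = small_last n j (j + 2 * d)"
    | s where "1 \<le> s" "s \<le> (n - 2) div 2" "\<pi> = three_first n (2 * s)"
    by (auto simp: large_firsts_def medium_firsts_def small_lasts_def three_firsts_def)
  then have "(\<exists>p. avoider n \<pi> p) \<and> 3 \<le> \<pi> 1"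
  proof cases
    case 1
    then have "n + 3 \<le> 2 * j" by simp
    moreover from this have "3 \<le> \<pi> 1" using 1 n by (simp add: large_first_def)
    ultimately show ?thesis using 1 avoider_large_first by blast
  next
    case 2
    then have "2 * j \<le> n + 2" by simp
    moreover have "3 \<le> \<pi> 1" using 2 n by (simp add: medium_first_def)
    ultimately show ?thesis using 2 avoider_medium_first by blast
  next
    case 3
    then have "2 * j + 2 * d \<le> n + 1" by simp
    moreover have "3 \<le> \<pi> 1" using 3 n by (simp add: small_last_def)
    ultimately show ?thesis using 3 avoider_small_last by blast
  next
    case 4
    then have "2 * s + 2 \<le> n" using n by simp
    moreover have "3 \<le> \<pi> 1" using 4 n by (simp add: three_first_def)
    ultimately show ?thesis using 4 avoider_three_first by blast
  qed
  then show "\<pi> \<in> avoiders_first_ge_3 n" by (simp add: avoiders_first_ge_3_def avoiders_def)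
qed

text \<open>The first and the last entry tell the four families apart, so that their sizes add
  up.\<close>

lemma large_firsts_values:
  assumes "\<pi> \<in> large_firsts n" "2 \<le> n"
  shows "n + 3 \<le> 2 * \<pi> 1" "2 \<le> \<pi> n"
  using assms by (auto simp: large_firsts_def large_first_def)

lemma small_lasts_values:
  assumes "\<pi> \<in> small_lasts n" "2 \<le> n"
  shows "2 * \<pi> 1 \<le> n + 1" "2 \<le> \<pi> n"
  using assms by (auto simp: small_lasts_def small_last_def)

lemma medium_firsts_values:
  assumes "\<pi> \<in> medium_firsts n" "2 \<le> n"
  shows "4 \<le> \<pi> 1" "\<pi> n = 1"
  using assms by (auto simp: medium_firsts_def medium_first_def)

lemma three_firsts_values:
  assumes "\<pi> \<in> three_firsts n" "2 \<le> n"
  shows "\<pi> 1 = 3" "\<pi> n = 1"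
  using assms by (auto simp: three_firsts_def three_first_def)

lemma card_large_firsts:
  assumes "2 \<le> n"
  shows "card (large_firsts n) = (n + 1) div 2 - 1"
proof -
  have "inj_on (large_first n) {(n + 4) div 2..n}"
  proof (rule inj_onI)
    fix i j
    assume *: "i \<in> {(n + 4) div 2..n}" "j \<in> {(n + 4) div 2..n}"
      and "large_first n i = large_first n j"
    then have "large_first n i 1 = large_first n j 1" by simp
    then show "i = j" using * assms by (simp add: large_first_def)
  qed
  then have "card (large_firsts n) = n + 1 - (n + 4) div 2"
    by (simp add: large_firsts_def card_image)
  then show ?thesis by simp
qed

lemma card_medium_firsts:
  assumes "2 \<le> n"
  shows "card (medium_firsts n) = (n + 2) div 2 - 3"
proof -
  have "inj_on (medium_first n) {4..(n + 2) div 2}"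
  proof (rule inj_onI)
    fix i j
    assume "medium_first n i = medium_first n j"
    then have "medium_first n i 1 = medium_first n j 1" by simp
    then show "i = j" using assms by (simp add: medium_first_def)
  qed
  then show ?thesis
    by (simp add: medium_firsts_def card_image)
qed

lemma card_three_firsts:
  assumes "2 \<le> n"
  shows "card (three_firsts n) = (n - 2) div 2"
proof -
  have False if *: "s < t" "1 \<le> s" "2 * t + 2 \<le> n"
    and eq: "three_first n (2 * s) = three_first n (2 * t)" for s t
  proof -
    \<comment> \<open>At the smaller exceptional point one map takes the value \<open>n\<close>,
      while the other still steps by 2.\<close>
    have "three_first n (2 * s) (2 * s) = n" "three_first n (2 * t) (2 * s) = 2 * s + 2"
      using * by (auto simp: three_first_def)
    then show False using * unfolding eq by simp
  qed
  then have "inj_on (\<lambda>s. three_first n (2 * s)) {1..(n - 2) div 2}"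
    using assms by (intro linorder_inj_onI) force+
  then show ?thesis by (simp add: three_firsts_def card_image)
qed

lemma card_pairs:
  "finite {(j, d). 3 \<le> j \<and> j + d \<le> h}" (is "finite (?P h)")
  "card {(j, d). 3 \<le> j \<and> j + d \<le> h} = (h - 1) choose 2"
proof -
  have fin: "finite (?P h)" for h
    by (rule finite_subset[of _ "{..h} \<times> {..h}"]) auto
  then show "finite (?P h)" .
  show "card (?P h) = (h - 1) choose 2"
  proof (induction h)
    case 0
    have "?P 0 = {}" by auto
    then show ?case by (simp only: card.empty) simp
  next
    case (Suc h)
    \<comment> \<open>The pairs with \<open>j + d = Suc h\<close>; there are \<open>h - 1\<close> of
      them, also for \<open>h \<le> 1\<close>, where both counts are 0.\<close>
    let ?D = "(\<lambda>j. (j, Suc h - j)) ` {3..Suc h}"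
    have "?P (Suc h) = ?P h \<union> ?D" by force
    moreover have "?P h \<inter> ?D = {}" by auto
    moreover have "card ?D = h - 1" by (subst card_image) (auto simp: inj_on_def)
    ultimately have "card (?P (Suc h)) = ((h - 1) choose 2) + (h - 1)"
      using Suc.IH fin[of h] by (simp add: card_Un_disjoint)
    also have "\<dots> = (Suc h - 1) choose 2"
      by (cases h) (simp_all add: numeral_2_eq_2)
    finally show ?case .
  qed
qed

lemma card_small_lasts:
  assumes "2 \<le> n"
  shows "card (small_lasts n) = ((n + 1) div 2 - 1) choose 2"
proof -
  have no: False if *: "d < e" "3 \<le> j" "2 * j + 2 * e \<le> n + 1"
    and eq: "small_last n j (j + 2 * d) = small_last n j (j + 2 * e)" for j d e
  proof -
    have "small_last n j (j + 2 * d) (j + 2 * d) = n + 3 - j"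
      "small_last n j (j + 2 * e) (j + 2 * d) = j + 2 * d + 2"
      using * by (auto simp: small_last_def)
    \<comment> \<open>Equal values would mean \<open>2 * j + 2 * d = n + 1\<close>, which
      \<open>d < e\<close> excludes.\<close>
    then show False using * unfolding eq by simp
  qed
  have "inj_on (\<lambda>(j, d). small_last n j (j + 2 * d)) {(j, d). 3 \<le> j \<and> j + d \<le> (n + 1) div 2}"
  proof (rule inj_onI, clarify)
    fix i d j e
    assume *: "3 \<le> i" "i + d \<le> (n + 1) div 2" "3 \<le> j" "j + e \<le> (n + 1) div 2"
      and eq: "small_last n i (i + 2 * d) = small_last n j (j + 2 * e)"
    then have "small_last n i (i + 2 * d) 1 = small_last n j (j + 2 * e) 1" by simp
    then have "i = j" using assms by (simp add: small_last_def)
    moreover have "2 * i + 2 * d \<le> n + 1" "2 * j + 2 * e \<le> n + 1" using * by presburger+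
    moreover have "\<not> d < e" "\<not> e < d"
      using no[of d e i] no[of e d i] *(1) eq calculation by auto
    ultimately show "i = j \<and> d = e" by simp
  qed
  then show ?thesis by (simp add: small_lasts_def card_image card_pairs(2))
qed

lemma finite_families:
  "finite (large_firsts n)" "finite (small_lasts n)"
  "finite (medium_firsts n)" "finite (three_firsts n)"
  by (simp_all add: large_firsts_def small_lasts_def medium_firsts_def three_firsts_def card_pairs(1))

lemma last_1_Int_first_ge_3:
  assumes "2 \<le> n"
  shows "avoiders_last_1 n \<inter> avoiders_first_ge_3 n = medium_firsts n \<union> three_firsts n"
proof -
  have "avoiders_last_1 n \<inter> avoiders_first_ge_3 n = {\<pi> \<in> avoiders_first_ge_3 n. \<pi> n = 1}"
    by (auto simp: avoiders_last_1_def avoiders_first_ge_3_def)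
  also have "\<dots> = medium_firsts n \<union> three_firsts n"
    unfolding avoiders_first_ge_3_eq[OF assms]
    using large_firsts_values(2) small_lasts_values(2) medium_firsts_values(2)
      three_firsts_values(2) assms by fastforce
  finally show ?thesis .
qed

lemma card_medium_Un_three:
  assumes "2 \<le> n"
  shows "card (medium_firsts n \<union> three_firsts n) = ((n + 2) div 2 - 3) + (n - 2) div 2"
proof -
  have "medium_firsts n \<inter> three_firsts n = {}"
    using medium_firsts_values(1) three_firsts_values(1) assms by fastforce
  then show ?thesis
    using assms by (simp add: card_Un_disjoint finite_families card_medium_firsts card_three_firsts)
qed

lemma card_large_Un_small:
  assumes "2 \<le> n"
  shows "card (large_firsts n \<union> small_lasts n) =
    ((n + 1) div 2 - 1) + (((n + 1) div 2 - 1) choose 2)"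
proof -
  have "large_firsts n \<inter> small_lasts n = {}"
    using large_firsts_values(1) small_lasts_values(1) assms by fastforce
  then show ?thesis
    using assms by (simp add: card_Un_disjoint finite_families card_large_firsts card_small_lasts)
qed

section \<open>Recursion and closed form\<close>

lemma finite_avoiders: "finite (avoiders n)"
proof (rule finite_subset)
  show "avoiders n \<subseteq> {\<pi>. \<pi> permutes {1..n}}"
    using avoider.axioms(1) cycle_position.permutes unfolding avoiders_def by blast
qed (simp add: finite_permutations)

lemma card_avoiders_last_1:
  assumes "2 \<le> n"
  shows "card (avoiders_last_1 n) =
    card (avoiders_last_1 (n - 1)) + ((n + 2) div 2 - 3) + (n - 2) div 2"
proof -
  have "finite (avoiders_first_2 n)" using finite_avoiders by (simp add: avoiders_first_2_def)
  moreover have "avoiders_first_2 n \<inter> (avoiders_last_1 n \<inter> avoiders_first_ge_3 n) = {}"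
    by (auto simp: avoiders_first_2_def avoiders_first_ge_3_def)
  ultimately have "card (avoiders_last_1 n) =
      card (avoiders_first_2 n) + card (medium_firsts n \<union> three_firsts n)"
    using avoiders_last_1_eq_Un[OF assms] assms
    by (metis card_Un_disjoint finite_UnI finite_families(3,4) last_1_Int_first_ge_3)
  then show ?thesis
    using card_avoiders_first_2[of "n - 1"] card_medium_Un_three[OF assms] assms by simp
qed

lemma card_avoiders:
  assumes "2 \<le> n"
  shows "card (avoiders n) =
    card (avoiders_last_1 n) + ((n + 1) div 2 - 1) + (((n + 1) div 2 - 1) choose 2)"
proof -
  have "avoiders n = avoiders_last_1 n \<union> (large_firsts n \<union> small_lasts n)"
    using avoiders_eq_Un[OF assms] avoiders_last_1_eq_Un[OF assms]
      last_1_Int_first_ge_3[OF assms] avoiders_first_ge_3_eq[OF assms] by blast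
  moreover have "avoiders_last_1 n \<inter> (large_firsts n \<union> small_lasts n) = {}"
    using large_firsts_values(2) small_lasts_values(2) assms
    by (fastforce simp: avoiders_last_1_def)
  moreover have "finite (avoiders_last_1 n)" using finite_avoiders by (simp add: avoiders_last_1_def)
  ultimately show ?thesis
    using card_large_Un_small[OF assms] by (simp add: card_Un_disjoint finite_families)
qed

lemma card_avoiders_last_1_3: "card (avoiders_last_1 3) = 1"
  using card_avoiders_last_1[of 2] card_avoiders_last_1[of 3] card_avoiders_last_1_1 by simp

text \<open>The added term is the size of \<open>large_firsts\<close>. It evens out the parity in
  the recursion: the sum grows by exactly \<open>n - 2\<close>, as Pascal's rule requires. The
  induction starts at 3 since the truncated \<open>(n + 2) div 2 - 3\<close> is a true difference
  from size 4 on.\<close>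

lemma card_avoiders_last_1_closed:
  assumes "3 \<le> n"
  shows "card (avoiders_last_1 n) + ((n + 1) div 2 - 1) = ((n - 2) choose 2) + 2"
  using assms
proof (induction n rule: dec_induct)
  case base
  then show ?case using card_avoiders_last_1_3 by simp
next
  case (step n)
  have "Suc n - 2 = Suc (n - 2)" using step.hyps by simp
  then have "(Suc n - 2) choose 2 = (n - 2) + ((n - 2) choose 2)"
    by (simp add: numeral_2_eq_2)
  moreover have "((Suc n + 2) div 2 - 3) + (Suc n - 2) div 2 + ((Suc n + 1) div 2 - 1)
      = (n - 2) + ((n + 1) div 2 - 1)"
    using step.hyps by (cases "even n") (auto elim!: evenE oddE)
  moreover have "card (avoiders_last_1 (Suc n)) =
      card (avoiders_last_1 n) + ((Suc n + 2) div 2 - 3) + (Suc n - 2) div 2"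
    using card_avoiders_last_1[of "Suc n"] step.hyps by simp
  ultimately show ?case using step.IH by linarith
qed

lemma num_cyc_avoiders_closed:
  assumes "3 \<le> n"
  shows "num_cyc_avoiders n [2,1,3] [3,2,1] = ((n - 2) choose 2) + (((n - 1) div 2) choose 2) + 2"
proof -
  have "num_cyc_avoiders n [2,1,3] [3,2,1] = card (avoiders n)"
    unfolding num_cyc_avoiders_def avoiders_def using assms by (subst cyc_avoiders_eq) auto
  moreover have half: "(n + 1) div 2 - 1 = (n - 1) div 2" using assms by simp
  moreover have "card (avoiders n) =
      card (avoiders_last_1 n) + (n - 1) div 2 + (((n - 1) div 2) choose 2)"
    using card_avoiders[of n] assms unfolding half by simp
  moreover have "card (avoiders_last_1 n) + (n - 1) div 2 = ((n - 2) choose 2) + 2"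
    using card_avoiders_last_1_closed[OF assms] unfolding half .
  ultimately show ?thesis by linarith
qed

theorem theorem6p12:
  fixes n :: nat
  assumes "n \<ge> 4"
  shows "num_cyc_avoiders n [2,1,3] [3,2,1] =
           (if even n then num_cyc_avoiders (n - 1) [2,1,3] [3,2,1] + (n - 3)
            else num_cyc_avoiders (n - 1) [2,1,3] [3,2,1] + (n - 3) + (n - 3) div 2)
       \<and> num_cyc_avoiders n [2,1,3] [3,2,1] =
           ((n - 2) choose 2) + (nat \<lceil>(real n - 2) / 2\<rceil> choose 2) + 2"
proof
  have closed: "num_cyc_avoiders n [2,1,3] [3,2,1] = ((n - 2) choose 2) + (((n - 1) div 2) choose 2) + 2"
    using assms by (intro num_cyc_avoiders_closed) simp
  have closed': "num_cyc_avoiders (n - 1) [2,1,3] [3,2,1] = ((n - 3) choose 2) + (((n - 2) div 2) choose 2) + 2"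
    using num_cyc_avoiders_closed[of "n - 1"] assms by (simp add: numeral_3_eq_3 numeral_2_eq_2)
  have pascal: "Suc k choose 2 = k + (k choose 2)" for k
    by (simp add: numeral_2_eq_2)
  have "n - 2 = Suc (n - 3)" using assms by simp
  then have step: "(n - 2) choose 2 = (n - 3) + ((n - 3) choose 2)"
    using pascal by metis
  show "num_cyc_avoiders n [2,1,3] [3,2,1] =
           (if even n then num_cyc_avoiders (n - 1) [2,1,3] [3,2,1] + (n - 3)
            else num_cyc_avoiders (n - 1) [2,1,3] [3,2,1] + (n - 3) + (n - 3) div 2)"
  proof (cases "even n")
    case True
    then have "(n - 1) div 2 = (n - 2) div 2" using assms by presburger
    then show ?thesis using True closed closed' step by simp
  next
    case False
    \<comment> \<open>Only for odd \<open>n\<close> does the second binomial coefficient advance,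
      which by Pascal's rule adds \<open>(n - 3) div 2\<close>.\<close>
    then have "(n - 1) div 2 = Suc ((n - 3) div 2)" "(n - 2) div 2 = (n - 3) div 2"
      using assms by presburger+
    then show ?thesis using False closed closed' step pascal[of "(n - 3) div 2"] by simp
  qed
  \<comment> \<open>Half of \<open>n - 2\<close> rounded up is half of \<open>n - 1\<close> rounded
    down.\<close>
  have "\<lceil>(real n - 2) / 2\<rceil> = int ((n - 1) div 2)"
    using assms by (intro ceiling_unique) (cases "even n"; auto elim!: evenE oddE simp: field_simps)+
  then show "num_cyc_avoiders n [2,1,3] [3,2,1] =
           ((n - 2) choose 2) + (nat \<lceil>(real n - 2) / 2\<rceil> choose 2) + 2"
    using closed by simp
qed

end
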